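(* Let $0<\alpha<2$ and $m>0$, let $X^m_t$ be the one-dimensional ($d=1$) relativistic $\alpha$-stable process with parameter $m$, and let $\tau_{(0,\infty)}=\inf\{t\ge 0: X^m_t\notin(0,\infty)\}$. For $x>0$ let $Q^m_{(0,\infty)}(x,u)$ denote the density with respect to Lebesgue measure of the measure $$A\mapsto E^x\left[\tau_{(0,\infty)}<\infty;\ e^{-m\tau_{(0,\infty)}}\mathbf 1_A(X^m_{\tau_{(0,\infty)}})\right],\qquad A\subset(-\infty,0]\ \text{Borel}.$$ Then this density exists and for $u<0<x$ $$Q^m_{(0,\infty)}(x,u)=\frac{\sin(\pi\alpha/2)}{\pi}\left(\frac{x}{-u}\right)^{\alpha/2}\frac{e^{-m^{1/\alpha}(x-u)}}{x-u}.$$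
   Context: For $0<\alpha<2$, $m>0$, the relativistic $\alpha$-stable process $X^m_t$ with parameter $m$ on $\mathbb R$ is the Lévy process with càdlàg paths whose characteristic function is $E^0e^{izX^m_t}=e^{mt}e^{-t(|z|^2+m^{2/\alpha})^{\alpha/2}}$, $z\in\mathbb R$. Its infinitesimal generator is $mI-(m^{2/\alpha}I-\frac{d^2}{dx^2})^{\alpha/2}$. $P^x,E^x$ denote probability and expectation for the process started at $x$; $E^x[A;Y]$ means $E^x[\mathbf 1_AY]$. *)

theory Defs
  imports "HOL-Probability.Probability"
begin

definition cadlag :: "(real \<Rightarrow> real) \<Rightarrow> bool" where
  "cadlag f \<longleftrightarrow>
     (\<forall>t\<ge>0. continuous (at_right t) f) \<and> (\<forall>t>0. \<exists>l. (f \<longlongrightarrow> l) (at_left t))"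

text \<open>
  Levy processes started at 0, with time parameter restricted to \<open>t \<ge> 0\<close> (values of \<open>X\<close> at negative
  times are irrelevant). As usual, the starting point and the regularity of the paths are
  prescribed almost surely. Stochastic continuity follows from the other conditions.
\<close>

locale levy_process = prob_space M for M :: "'w measure" +
  fixes X :: "real \<Rightarrow> 'w \<Rightarrow> real"
  assumes random_variable: "\<And>t. 0 \<le> t \<Longrightarrow> X t \<in> borel_measurable M"
    and start_zero: "AE \<omega> in M. X 0 \<omega> = 0"
    and independent_increments:
      "\<And>(n::nat) (t::nat \<Rightarrow> real). 0 \<le> t 0 \<Longrightarrow> (\<forall>i<n. t i \<le> t (Suc i)) \<Longrightarrow>
         indep_vars (\<lambda>_. borel) (\<lambda>i \<omega>. X (t (Suc i)) \<omega> - X (t i) \<omega>) {..<n}"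
    and stationary_increments:
      "\<And>s t. 0 \<le> s \<Longrightarrow> 0 \<le> t \<Longrightarrow>
         distr M borel (\<lambda>\<omega>. X (s + t) \<omega> - X s \<omega>) = distr M borel (\<lambda>\<omega>. X t \<omega> - X 0 \<omega>)"
    and cadlag_paths: "AE \<omega> in M. cadlag (\<lambda>t. X t \<omega>)"

locale relativistic_stable_process = levy_process M X
  for M :: "'w measure" and X :: "real \<Rightarrow> 'w \<Rightarrow> real" +
  fixes \<alpha> m :: real
  assumes char_relativistic:
    "\<And>t z. 0 \<le> t \<Longrightarrow> char (distr M borel (X t)) z =
       complex_of_real (exp (m * t) * exp (- t * (\<bar>z\<bar>\<^sup>2 + m powr (2 / \<alpha>)) powr (\<alpha> / 2)))"

definition exit_time :: "(real \<Rightarrow> 'w \<Rightarrow> real) \<Rightarrow> real set \<Rightarrow> 'w \<Rightarrow> ennreal" where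
  "exit_time Y D \<omega> = Inf (ennreal ` {t. 0 \<le> t \<and> Y t \<omega> \<notin> D})"

text \<open>
  The measure \<open>A \<mapsto> E[\<tau> < \<infinity>; exp (- q \<tau>) 1\<^sub>A(Y\<^sub>\<tau>)]\<close> on the Borel subsets of the complement of \<open>D\<close>,
  where \<open>\<tau>\<close> is the exit time of \<open>Y\<close> from \<open>D\<close>. The expectation is taken with respect to the
  completion of \<open>M\<close>: the first time at which a cadlag path lies in a closed set is in general
  measurable only up to null sets. Note that the Bochner integral is 0 for a non-measurable
  integrand, and that \<open>measure_of\<close> gives the null measure if the set function is not countably
  additive; an equation between \<open>exit_measure\<close> and a nonzero measure excludes both degeneracies.
\<close>

definition exit_measure ::
    "'w measure \<Rightarrow> (real \<Rightarrow> 'w \<Rightarrow> real) \<Rightarrow> real \<Rightarrow> real set \<Rightarrow> real measure" where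
  "exit_measure M Y q D =
     measure_of (- D) (sets (restrict_space borel (- D)))
       (\<lambda>A. ennreal (\<integral>\<omega>. indicator {\<omega>. exit_time Y D \<omega> < \<infinity>} \<omega> *
               exp (- q * enn2real (exit_time Y D \<omega>)) *
               indicator A (Y (enn2real (exit_time Y D \<omega>)) \<omega>) \<partial>completion M))"

end

theory Submission
  imports Defs
begin

text \<open>
  Write \<open>a = \<alpha> / 2\<close> and \<open>b = m powr (1 / \<alpha>)\<close>, so that the process killed at rate \<open>m\<close> has the exponent
  \<open>(b\<^sup>2 + z\<^sup>2) powr a\<close>.  This is the squared modulus of \<open>(b - \<i> z) powr a\<close>, which is, up to a constant, the reciprocal of the
  characteristic function of the Gamma distribution with shape \<open>a\<close> and rate \<open>b\<close>.  Hence the position at an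
  independent exponential time with rate \<open>m\<close> is distributed as the difference of two independent Gamma variables
  (\<open>law_at_exponential_time\<close>).  This explicit Wiener-Hopf factorisation is what makes the exit law computable.

  Let \<open>\<sigma>\<close> be the first time at which the path started in \<open>x\<close> is negative, and \<open>U\<close> the position at that time.  Let \<open>K h u\<close> be the
  expectation of \<open>h\<close> at the position of the process started in \<open>u\<close> at the independent exponential time.  If \<open>h\<close> vanishes on
  \<open>[0, \<infinity>)\<close>, only times after \<open>\<sigma>\<close> contribute to \<open>K h x\<close>, so the Markov property gives
  \<open>K h x = E[\<sigma> < \<infinity>; exp (- m \<sigma>) K h U]\<close> (\<open>balayage\<close>).  The shifted Gamma densities \<open>h v = gamma_density (1 - a) b (y - v)\<close> with \<open>y \<le> 0\<close> are
  the right test functions: the shapes \<open>a\<close> and \<open>1 - a\<close> add up to an exponential distribution, and \<open>K h u\<close> becomes a multiple of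
  \<open>exp (b u) G (u - y)\<close>, where \<open>G\<close> is the tail of the Gamma distribution with shape \<open>a\<close> and rate \<open>2 b\<close>
  (\<open>nn_integral_gamma_difference_kernel\<close>).  Thus the integrals of \<open>G (u - y)\<close>, \<open>y \<le> 0\<close>, against the law of \<open>U\<close> weighted by
  \<open>exp (- m \<sigma> + b u)\<close> are known.  They are values of the distribution function of a convolution with a Gamma
  distribution, whose characteristic function has no zeros, so they determine the law (\<open>gamma_tails_determine_measure\<close>).
  A Beta integral shows that the density in the theorem has the same integrals (\<open>overshoot_density_potential\<close>),
  which identifies the law at \<open>\<sigma>\<close> (\<open>hitting_law_eq\<close>).

  The theorem concerns the first time \<open>\<tau>\<close> in the closed half-line, which may a priori be smaller than \<open>\<sigma>\<close>.  But
  for \<open>x' < x\<close> the time \<open>\<tau>\<close> lies between the times \<open>\<sigma>\<close> for the starting points \<open>x'\<close> and \<open>x\<close>, and the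
  mass \<open>E[exp (- m \<sigma>)]\<close> is continuous in the starting point by the explicit formula.  So \<open>\<tau> = \<sigma>\<close> almost
  surely (\<open>AE_exit_time_eq\<close>).
\<close>

section \<open>Gamma distributions\<close>

definition gamma_density :: "real \<Rightarrow> real \<Rightarrow> real \<Rightarrow> real" where
  "gamma_density a b s =
     (if 0 < s then b powr a / Gamma a * s powr (a - 1) * exp (- b * s) else 0)"

lemma borel_measurable_gamma_density [measurable]: "gamma_density a b \<in> borel_measurable borel"
  unfolding gamma_density_def by measurable

lemma gamma_density_nonneg: "0 < a \<Longrightarrow> 0 \<le> gamma_density a b s"
  by (auto simp: gamma_density_def intro!: mult_nonneg_nonneg divide_nonneg_pos Gamma_real_pos)

lemma nn_integral_gamma_density:
  assumes a: "0 < a" and b: "0 < b"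
  shows "(\<integral>\<^sup>+s. ennreal (gamma_density a b s) \<partial>lborel) = 1"
proof -
  have G: "Gamma a > 0" using a by (rule Gamma_real_pos)
  have "ennreal (Gamma a) = (\<integral>\<^sup>+t. ennreal (indicator {0..} t * t powr (a - 1) / exp t) \<partial>lborel)"
    by (rule Gamma_conv_nn_integral_real[OF a])
  also have "\<dots> = b * (\<integral>\<^sup>+t. ennreal (indicator {0..} (b * t) * (b * t) powr (a - 1) / exp (b * t)) \<partial>lborel)"
    using b by (subst nn_integral_real_affine[where c = b and t = 0]) auto
  also have "\<dots> = (\<integral>\<^sup>+t. ennreal (Gamma a) * ennreal (gamma_density a b t) \<partial>lborel)"
  proof (subst nn_integral_cmult[symmetric], measurable, intro nn_integral_cong_AE)
    show "AE t in lborel. ennreal b * ennreal (indicator {0..} (b * t) * (b * t) powr (a - 1) / exp (b * t)) =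
            ennreal (Gamma a) * ennreal (gamma_density a b t)"
      using AE_lborel_singleton[of 0]
    proof eventually_elim
      fix t :: real assume "t \<noteq> 0"
      have "b powr a = b * b powr (a - 1)" using b by (simp add: powr_mult_base)
      then have "b * (indicator {0..} (b * t) * (b * t) powr (a - 1) / exp (b * t)) =
            Gamma a * gamma_density a b t"
        using b \<open>t \<noteq> 0\<close> G
        by (auto simp: gamma_density_def indicator_def powr_mult zero_le_mult_iff exp_minus field_simps)
      then show "ennreal b * ennreal (indicator {0..} (b * t) * (b * t) powr (a - 1) / exp (b * t)) =
            ennreal (Gamma a) * ennreal (gamma_density a b t)"
        using b G by (metis ennreal_mult' less_imp_le)
    qed
  qed
  also have "\<dots> = ennreal (Gamma a) * (\<integral>\<^sup>+t. ennreal (gamma_density a b t) \<partial>lborel)"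
    by (simp add: nn_integral_cmult)
  finally have "ennreal (Gamma a) * 1 = ennreal (Gamma a) * (\<integral>\<^sup>+t. ennreal (gamma_density a b t) \<partial>lborel)"
    by simp
  with G show ?thesis
    by (subst (asm) ennreal_mult_cancel_left) auto
qed

definition gamma_measure :: "real \<Rightarrow> real \<Rightarrow> real measure" where
  "gamma_measure a b = density lborel (\<lambda>s. ennreal (gamma_density a b s))"

lemma sets_gamma_measure [measurable_cong, simp]: "sets (gamma_measure a b) = sets borel"
  by (simp add: gamma_measure_def)

lemma space_gamma_measure [simp]: "space (gamma_measure a b) = UNIV"
  by (simp add: gamma_measure_def)

lemma real_distribution_gamma:
  assumes "0 < a" "0 < b"
  shows "real_distribution (gamma_measure a b)"
proof -
  interpret prob_space "gamma_measure a b"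
    by standard (simp add: gamma_measure_def emeasure_density nn_integral_gamma_density assms)
  show ?thesis by standard auto
qed

lemma AE_gamma_measure_pos: "AE s in gamma_measure a b. 0 < s"
  unfolding gamma_measure_def by (subst AE_density) (auto simp: gamma_density_def)

text \<open>
  The powers of \<open>s\<close> only raise the shape, so the moments are ratios of normalising constants; they are the
  coefficients of the binomial series below.
\<close>

lemma gamma_moments:
  assumes a: "0 < a" and b: "0 < b"
  shows "has_bochner_integral lborel (\<lambda>s. s ^ n * gamma_density a b s) (pochhammer a n / b ^ n)"
proof -
  have an: "0 < a + n" using a by simp
  have "a \<notin> \<int>\<^sub>\<le>\<^sub>0" using a by (auto elim!: nonpos_Ints_cases)
  then have ph: "pochhammer a n = Gamma (a + n) / Gamma a" by (rule pochhammer_Gamma)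
  have "has_bochner_integral lborel (gamma_density (a + n) b) 1"
    using nn_integral_gamma_density[OF an b] gamma_density_nonneg[OF an]
    by (intro has_bochner_integral_nn_integral) auto
  from has_bochner_integral_mult_right[OF this, of "pochhammer a n / b ^ n"]
  have "has_bochner_integral lborel (\<lambda>s. pochhammer a n / b ^ n * gamma_density (a + n) b s) (pochhammer a n / b ^ n)"
    by simp
  moreover have "pochhammer a n / b ^ n * gamma_density (a + n) b s = s ^ n * gamma_density a b s" for s
  proof (cases "0 < s")
    case True
    then have "s powr (a + n - 1) = s powr (a - 1) * s ^ n" "b powr (a + n) = b powr a * b ^ n"
      using b by (simp_all add: powr_realpow[symmetric] powr_add[symmetric] algebra_simps)
    with True show ?thesis
      using b Gamma_real_pos[OF an] by (simp add: gamma_density_def ph)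
  qed (simp add: gamma_density_def)
  ultimately show ?thesis by simp
qed

text \<open>
  The power series of the exponential around a real rate \<open>c\<close> turns the Laplace transform of the Gamma density
  into the binomial series.  It converges at \<open>w\<close> as soon as \<open>w\<close> lies in the disc of radius \<open>c\<close>
  around \<open>c\<close>, and every \<open>w\<close> in the right half-plane lies in such a disc for large \<open>c\<close>.
\<close>

lemma integral_exp_gamma_density:
  fixes w :: complex
  assumes a: "0 < a" and c: "0 < c" and w: "norm (of_real c - w) < c"
  shows "(\<integral>s. exp ((of_real c - w) * of_real s) * of_real (gamma_density a c s) \<partial>lborel) =
           (w / of_real c) powr (of_real (- a))"
proof -
  define d where "d = of_real c - w"
  have d: "norm d < c" using w by (simp add: d_def)
  define f :: "nat \<Rightarrow> real \<Rightarrow> complex" where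
    "f n s = (d ^ n / fact n) * of_real (s ^ n * gamma_density a c s)" for n s
  have hb: "has_bochner_integral lborel (f n) ((d ^ n / fact n) * of_real (pochhammer a n / c ^ n))" for n
    unfolding f_def by (intro has_bochner_integral_mult_right has_bochner_integral_of_real gamma_moments a c)
  have sf: "(\<lambda>n. f n s) sums (exp (d * of_real s) * of_real (gamma_density a c s))" for s
  proof -
    have "(\<lambda>n. (d * of_real s) ^ n /\<^sub>R fact n * of_real (gamma_density a c s)) sums
        (exp (d * of_real s) * of_real (gamma_density a c s))"
      by (intro sums_mult2 exp_converges)
    then show ?thesis
      by (simp add: f_def scaleR_conv_of_real power_mult_distrib field_simps)
  qed
  have nf: "norm (f n s) = (norm d ^ n / fact n) * (s ^ n * gamma_density a c s)" for n s
    using gamma_density_nonneg[OF a, of c s]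
    by (auto simp: f_def norm_mult norm_divide norm_power gamma_density_def abs_mult power_abs)
  have nsum: "summable (\<lambda>n. norm (f n s))" for s
  proof -
    have "summable (\<lambda>n. (norm d * s) ^ n /\<^sub>R fact n * gamma_density a c s)"
      using exp_converges[of "norm d * s"] by (intro summable_mult2) (auto simp: sums_iff)
    then show ?thesis
      by (simp add: nf power_mult_distrib field_simps)
  qed
  have coef: "y ^ n / fact n * (pochhammer a n / c ^ n) = ((- a) gchoose n) * (- (y / c)) ^ n" for y :: real and n
    by (simp add: gbinomial_pochhammer power_mult_distrib[symmetric] field_simps flip: power_divide)
      (simp add: field_simps power_mult_distrib[symmetric])
  have int_norm: "(\<integral>s. norm (f n s) \<partial>lborel) = ((- a) gchoose n) * (- (norm d / c)) ^ n" for n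
  proof -
    have "has_bochner_integral lborel (\<lambda>s. norm (f n s)) ((norm d ^ n / fact n) * (pochhammer a n / c ^ n))"
      unfolding nf by (intro has_bochner_integral_mult_right gamma_moments a c)
    then show ?thesis unfolding coef by (rule has_bochner_integral_integral_eq)
  qed
  have sums_norm: "summable (\<lambda>n. \<integral>s. norm (f n s) \<partial>lborel)"
    unfolding int_norm using gen_binomial_real[of "- (norm d / c)" "- a"] d c by (auto simp: sums_iff)
  have "(\<lambda>n. integral\<^sup>L lborel (f n)) sums (\<integral>s. (\<Sum>n. f n s) \<partial>lborel)"
    using hb nsum sums_norm by (intro sums_integral) (auto simp: has_bochner_integral_iff)
  moreover have "(\<lambda>s. \<Sum>n. f n s) = (\<lambda>s. exp (d * of_real s) * of_real (gamma_density a c s))"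
    using sf by (auto simp: sums_iff)
  moreover have "integral\<^sup>L lborel (f n) = (of_real (- a) gchoose n) * (- (d / of_real c)) ^ n" for n
  proof -
    have sign: "(- 1) ^ n * (p * (- (d / of_real c)) ^ n) = p * (d / of_real c) ^ n" for p :: complex
      by (simp add: mult.left_commute[of _ p] flip: power_mult_distrib)
    have "integral\<^sup>L lborel (f n) = (d ^ n / fact n) * of_real (pochhammer a n / c ^ n)"
      using hb[of n] by (rule has_bochner_integral_integral_eq)
    also have "\<dots> = (of_real (- a) gchoose n) * (- (d / of_real c)) ^ n"
      using sign[of "of_real (pochhammer a n)"]
      by (simp add: gbinomial_pochhammer pochhammer_of_real power_divide mult_ac)
    finally show ?thesis .
  qed
  ultimately have "(\<lambda>n. (of_real (- a) gchoose n) * (- (d / of_real c)) ^ n) sums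
      (\<integral>s. exp (d * of_real s) * of_real (gamma_density a c s) \<partial>lborel)"
    by simp
  moreover have "(\<lambda>n. (of_real (- a) gchoose n) * (- (d / of_real c)) ^ n) sums (1 + (- (d / of_real c))) powr of_real (- a)"
    using d c by (intro gen_binomial_complex) (simp add: norm_divide)
  moreover have "1 + (- (d / of_real c)) = w / of_real c"
    using c by (simp add: d_def field_simps)
  ultimately show ?thesis
    by (simp add: sums_iff d_def)
qed

text \<open>
  The modulus is all that the difference of two Gamma variables and the absence of zeros depend on, and it
  spares the choice of a branch of the complex power.
\<close>

lemma norm_char_gamma:
  assumes a: "0 < a" and b: "0 < b"
  shows "norm (char (gamma_measure a b) z) = (b\<^sup>2 / (b\<^sup>2 + z\<^sup>2)) powr (a / 2)"
proof -
  define w where "w = Complex b (- z)"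
  have nw: "norm w = sqrt (b\<^sup>2 + z\<^sup>2)" by (simp add: w_def complex_norm)
  \<comment> \<open>The disc of radius \<open>c\<close> around \<open>c\<close> contains \<open>b - \<i> z\<close> as soon as \<open>2 * b * c > b\<^sup>2 + z\<^sup>2\<close>.\<close>
  define c where "c = (b\<^sup>2 + z\<^sup>2) / b"
  have c: "0 < c" using b by (auto simp: c_def intro!: divide_pos_pos add_pos_nonneg)
  have "norm (of_real c - w) < c"
  proof -
    have "(c - b)\<^sup>2 + z\<^sup>2 < c\<^sup>2"
    proof -
      have "c * b = b\<^sup>2 + z\<^sup>2" using b by (simp add: c_def)
      moreover have "0 < b\<^sup>2" using b by simp
      moreover have "(c - b)\<^sup>2 + z\<^sup>2 = c\<^sup>2 - 2 * (c * b) + b\<^sup>2 + z\<^sup>2" by (simp add: power2_eq_square algebra_simps)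
      ultimately show ?thesis using zero_le_power2[of z] by linarith
    qed
    then have "sqrt ((c - b)\<^sup>2 + z\<^sup>2) < sqrt (c\<^sup>2)" by (rule real_sqrt_less_mono)
    then show ?thesis using c by (simp add: w_def complex_norm cmod_def)
  qed
  note eq = integral_exp_gamma_density[OF a c this]
  have "char (gamma_measure a b) z = (\<integral>s. gamma_density a b s *\<^sub>R iexp (z * s) \<partial>lborel)"
    unfolding char_def gamma_measure_def using gamma_density_nonneg[OF a]
    by (subst integral_density) auto
  also have "\<dots> = (\<integral>s. of_real ((b / c) powr a) * (exp ((of_real c - w) * of_real s) * of_real (gamma_density a c s)) \<partial>lborel)"
  proof (intro Bochner_Integration.integral_cong refl)
    fix s :: real
    show "gamma_density a b s *\<^sub>R iexp (z * s) =
        of_real ((b / c) powr a) * (exp ((of_real c - w) * of_real s) * of_real (gamma_density a c s))"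
    proof (cases "0 < s")
      case True
      have w: "w = of_real b - \<i> * of_real z" by (simp add: w_def complex_eq_iff)
      have "exp ((of_real c - w) * of_real s) = exp (of_real (c * s)) * exp (of_real (- b * s)) * iexp (z * s)"
        unfolding w exp_add[symmetric] by (simp add: algebra_simps)
      moreover have "exp (of_real c * of_real s :: complex) * exp (- (of_real c * of_real s)) = 1"
        by (simp add: exp_minus)
      moreover have "(b / c) powr a = b powr a / c powr a" using b c by (simp add: powr_divide)
      moreover have "c powr a \<noteq> 0" using c by simp
      ultimately show ?thesis using True 
        by (simp add: gamma_density_def scaleR_conv_of_real exp_of_real[symmetric])
    qed (simp add: gamma_density_def)
  qed
  also have "\<dots> = of_real ((b / c) powr a) * (w / of_real c) powr (of_real (- a))"
    by (simp add: eq del: of_real_minus)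
  finally have "norm (char (gamma_measure a b) z) = (b / c) powr a * (norm w / c) powr (- a)"
    using c by (simp add: norm_mult norm_powr_real_powr' norm_divide)
  also have "\<dots> = (b / norm w) powr a"
    using b c by (simp add: powr_divide powr_minus field_simps)
  also have "b / norm w = (b\<^sup>2 / (b\<^sup>2 + z\<^sup>2)) powr (1 / 2)"
    using b by (simp add: nw powr_half_sqrt real_sqrt_divide)
  finally show ?thesis by (simp add: powr_powr)
qed

section \<open>Characteristic functions and differences of Gamma variables\<close>

lemma char_distr_diff:
  assumes M: "finite_measure M" "sets M = sets borel" and N: "finite_measure N" "sets N = sets borel"
  shows "char (distr (M \<Otimes>\<^sub>M N) borel (\<lambda>(u, s). s - u)) z = cnj (char M z) * char N z"
proof -
  interpret M: finite_measure M by fact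
  interpret N: finite_measure N by fact
  interpret pair_sigma_finite M N ..
  interpret P: finite_measure "M \<Otimes>\<^sub>M N" by (rule finite_measure_pair_measure) fact+
  note M(2)[measurable_cong] N(2)[measurable_cong]
  have int: "integrable (M \<Otimes>\<^sub>M N) (\<lambda>(u, s). iexp (z * (s - u)))"
    by (rule P.integrable_const_bound[of _ 1]) (auto simp: split_beta' simp flip: of_real_diff of_real_mult)
  have "char (distr (M \<Otimes>\<^sub>M N) borel (\<lambda>(u, s). s - u)) z = (\<integral>p. (\<lambda>(u, s). iexp (z * (s - u))) p \<partial>(M \<Otimes>\<^sub>M N))"
    unfolding char_def by (subst integral_distr) (auto simp: split_beta')
  also have "\<dots> = (\<integral>u. (\<integral>s. iexp (z * (s - u)) \<partial>N) \<partial>M)"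
    using integral_fst'[OF int] by simp
  also have "\<dots> = (\<integral>u. (\<integral>s. cnj (iexp (z * u)) * iexp (z * s) \<partial>N) \<partial>M)"
    by (intro Bochner_Integration.integral_cong refl)
       (simp add: exp_cnj exp_add[symmetric] algebra_simps)
  also have "\<dots> = (\<integral>u. cnj (iexp (z * u)) \<partial>M) * (\<integral>s. iexp (z * s) \<partial>N)"
    by simp
  also have "(\<integral>u. cnj (iexp (z * u)) \<partial>M) = cnj (char M z)"
    unfolding char_def by (rule integral_bounded_linear'[OF bounded_linear_cnj bounded_linear_cnj]) auto
  finally show ?thesis by (simp add: char_def)
qed

lemma finite_measure_eqI_char:
  assumes M: "finite_measure M" "sets M = sets borel" and N: "finite_measure N" "sets N = sets borel"
    and eq: "char M = char N"
  shows "M = N"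
proof -
  have mass: "char L 0 = of_real (measure L UNIV)" if "sets L = sets borel" for L :: "real measure"
    using sets_eq_imp_space_eq[OF that] by (simp add: char_def scaleR_conv_of_real)
  define c where "c = measure M UNIV"
  have cN: "measure N UNIV = c"
    using mass[OF M(2)] mass[OF N(2)] eq by (simp add: c_def)
  have em: "emeasure L UNIV = ennreal (measure L UNIV)" if "finite_measure L" for L :: "real measure"
    using that by (simp add: finite_measure.emeasure_eq_measure)
  show ?thesis
  proof (cases "c = 0")
    case True
    have "emeasure L A = 0" if "measure L UNIV = c" "finite_measure L" "sets L = sets borel" for A and L :: "real measure"
      using emeasure_mono[of A UNIV L] em[of L] that True by simp
    then show ?thesis using M N cN by (intro measure_eqI) (auto simp: c_def)
  next
    case False
    then have c: "0 < c" by (simp add: c_def less_le)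
    \<comment> \<open>Both measures are normalised, so that the uniqueness theorem for probability distributions applies.\<close>
  define s where "s L = density L (\<lambda>_. ennreal (1 / c))" for L :: "real measure"
    have rd: "real_distribution (s L)" if L: "measure L UNIV = c" "finite_measure L" "sets L = sets borel" for L
    proof -
      have "emeasure (s L) (space (s L)) = ennreal (1 / c) * emeasure L UNIV"
        unfolding s_def using L(3) sets_eq_imp_space_eq[OF L(3)] by (simp add: emeasure_density)
      also have "\<dots> = 1" using em[OF L(2)] L(1) c by (simp add: ennreal_mult'[symmetric])
      finally interpret prob_space "s L" by (rule prob_spaceI)
      show ?thesis by standard (use L(3) in \<open>simp add: s_def\<close>)
    qed
    have ch: "char (s L) z = (1 / c) *\<^sub>R char L z" if "sets L = sets borel" for L z
    proof -
      note that[measurable_cong]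
      show ?thesis unfolding char_def s_def using c by (subst integral_density) (auto intro!: measurable_compose[OF _ borel_measurable_exp])
    qed
    have "s M = s N"
    proof (rule Levy_uniqueness)
      show "real_distribution (s M)" "real_distribution (s N)" using M N cN by (auto intro!: rd simp: c_def)
      show "char (s M) = char (s N)" using eq by (simp add: fun_eq_iff ch M N)
    qed
    show ?thesis
    proof (rule measure_eqI)
      show "sets M = sets N" using M N by simp
      fix A assume A: "A \<in> sets M"
      have "emeasure (s L) A = ennreal (1 / c) * emeasure L A" if "A \<in> sets L" for L
        using that by (simp add: s_def emeasure_density_const)
      then have "ennreal (1 / c) * emeasure M A = ennreal (1 / c) * emeasure N A"
        using A M N \<open>s M = s N\<close> by metis
      then show "emeasure M A = emeasure N A" using c by (simp add: ennreal_mult_cancel_left)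
    qed
  qed
qed

text \<open>
  The integrals are the tails of the law of \<open>s - u\<close>, with \<open>s\<close> Gamma distributed and \<open>u\<close> independent of it.
  As \<open>s - u\<close> is positive, the levels \<open>- y \<ge> 0\<close> give the whole law, and
  the nonvanishing characteristic function of \<open>s\<close> can be cancelled from its characteristic function.
\<close>

lemma gamma_tails_determine_measure:
  assumes a: "0 < a" and b: "0 < b"
    and M: "finite_measure M" "sets M = sets borel" "AE u in M. u \<le> 0"
    and N: "finite_measure N" "sets N = sets borel" "AE u in N. u \<le> 0"
    and eq: "\<And>y. y \<le> 0 \<Longrightarrow> (\<integral>\<^sup>+u. emeasure (gamma_measure a b) {u - y<..} \<partial>M) =
                              (\<integral>\<^sup>+u. emeasure (gamma_measure a b) {u - y<..} \<partial>N)"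
  shows "M = N"
proof -
  let ?G = "gamma_measure a b"
  interpret G: real_distribution ?G using a b by (rule real_distribution_gamma)
  define D where "D L = distr (L \<Otimes>\<^sub>M ?G) borel (\<lambda>(u, s). s - u)" for L
  have D: "emeasure (D L) {r<..} = (\<integral>\<^sup>+u. emeasure ?G {u + r<..} \<partial>L)" if [measurable_cong]: "sets L = sets borel" for L r
  proof -
    have "emeasure (D L) {r<..} = emeasure (L \<Otimes>\<^sub>M ?G) ((\<lambda>(u, s). s - u) -` {r<..} \<inter> space (L \<Otimes>\<^sub>M ?G))"
      unfolding D_def by (rule emeasure_distr) auto
    also have "\<dots> = (\<integral>\<^sup>+u. emeasure ?G (Pair u -` ((\<lambda>(u, s). s - u) -` {r<..} \<inter> space (L \<Otimes>\<^sub>M ?G))) \<partial>L)"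
      by (rule G.emeasure_pair_measure_alt) measurable
    also have "\<dots> = (\<integral>\<^sup>+u. emeasure ?G {u + r<..} \<partial>L)"
      by (intro nn_integral_cong arg_cong[where f="emeasure ?G"]) (auto simp: space_pair_measure)
    finally show ?thesis .
  qed
  have one: "emeasure ?G {r<..} = 1" if "r \<le> 0" for r
    using AE_gamma_measure_pos[of a b] that
    by (intro G.emeasure_eq_1_AE) (auto elim!: eventually_mono)
  have full: "(\<integral>\<^sup>+u. emeasure ?G {u + r<..} \<partial>L) = (\<integral>\<^sup>+u. emeasure ?G {u - 0<..} \<partial>L)"
    if "AE u in L. u \<le> 0" "r \<le> 0" for L r
    using that(1) by (intro nn_integral_cong_AE) (use that(2) in \<open>auto elim!: eventually_mono simp: one\<close>)
  have tails: "(\<integral>\<^sup>+u. emeasure ?G {u + r<..} \<partial>M) = (\<integral>\<^sup>+u. emeasure ?G {u + r<..} \<partial>N)" for r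
  proof (cases "r \<le> 0")
    case True
    then show ?thesis using full[OF M(3) True] full[OF N(3) True] eq[of 0] by simp
  qed (use eq[of "- r"] in simp)
  have fin: "finite_measure (D L)" if L: "finite_measure L" "sets L = sets borel" for L
  proof -
    note L(2)[measurable_cong]
    interpret finite_measure "L \<Otimes>\<^sub>M ?G"
      by (intro finite_measure_pair_measure L) (rule G.finite_measure_axioms)
    show ?thesis unfolding D_def by (rule finite_measure_distr) measurable
  qed
  have "D M = D N"
  proof (rule measure_eqI_lessThan)
    fix r
    interpret finite_measure "D M" using M by (intro fin)
    show "emeasure (D M) {r<..} < \<infinity>" by (simp add: emeasure_eq_measure)
    show "emeasure (D M) {r<..} = emeasure (D N) {r<..}" using M N tails by (simp add: D)
  qed (simp_all add: D_def)
  then have "cnj (char M z) * char ?G z = cnj (char N z) * char ?G z" for z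
    using char_distr_diff[OF M(1,2) G.finite_measure_axioms sets_gamma_measure, of z]
      char_distr_diff[OF N(1,2) G.finite_measure_axioms sets_gamma_measure, of z]
    unfolding D_def by metis
  moreover have "char ?G z \<noteq> 0" for z
  proof -
    have "0 < b\<^sup>2 + z\<^sup>2" using b by (simp add: add_pos_nonneg)
    then have "0 < norm (char ?G z)" using b by (subst norm_char_gamma[OF a b]) simp
    then show ?thesis by auto
  qed
  ultimately have "char M = char N" by (simp add: fun_eq_iff)
  with M N show ?thesis by (intro finite_measure_eqI_char)
qed

definition gamma_difference :: "real \<Rightarrow> real \<Rightarrow> real measure" where
  "gamma_difference a b = distr (gamma_measure a b \<Otimes>\<^sub>M gamma_measure a b) borel (\<lambda>(t, s). s - t)"

lemma sets_gamma_difference [measurable_cong, simp]: "sets (gamma_difference a b) = sets borel"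
  by (simp add: gamma_difference_def)

lemma real_distribution_gamma_difference:
  assumes "0 < a" "0 < b"
  shows "real_distribution (gamma_difference a b)"
proof -
  interpret G: real_distribution "gamma_measure a b" using assms by (rule real_distribution_gamma)
  interpret P: pair_prob_space "gamma_measure a b" "gamma_measure a b" ..
  interpret D: prob_space "gamma_difference a b"
    unfolding gamma_difference_def by (rule P.prob_space_distr) measurable
  show ?thesis by standard auto
qed

lemma char_gamma_difference:
  assumes a: "0 < a" and b: "0 < b"
  shows "char (gamma_difference a b) z = of_real ((b\<^sup>2 / (b\<^sup>2 + z\<^sup>2)) powr a)"
proof -
  interpret G: real_distribution "gamma_measure a b" using a b by (rule real_distribution_gamma)
  have "char (gamma_difference a b) z = cnj (char (gamma_measure a b) z) * char (gamma_measure a b) z"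
    unfolding gamma_difference_def by (rule char_distr_diff) (auto simp: G.finite_measure_axioms)
  also have "\<dots> = of_real ((norm (char (gamma_measure a b) z))\<^sup>2)"
    unfolding complex_norm_square by (rule mult.commute)
  also have "(norm (char (gamma_measure a b) z))\<^sup>2 = (b\<^sup>2 / (b\<^sup>2 + z\<^sup>2)) powr a"
  proof -
    have "(p powr (a / 2))\<^sup>2 = p powr a" for p :: real by (simp add: power2_eq_square powr_add[symmetric])
    then show ?thesis by (simp only: norm_char_gamma[OF a b])
  qed
  finally show ?thesis .
qed

section \<open>Beta integrals\<close>

lemma nn_integral_Beta:
  assumes "0 < a" "0 < c"
  shows "(\<integral>\<^sup>+t. ennreal (t powr (a - 1) * (1 - t) powr (c - 1) * indicator {0..1} t) \<partial>lborel) = ennreal (Beta a c)"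
  using nn_integral_has_integral_lebesgue[OF _ has_integral_Beta_real[OF assms]] by (simp add: mult_ac)

lemma gamma_density_convolution:
  assumes a: "0 < a" and c: "0 < c" and b: "0 < b"
  shows "(\<integral>\<^sup>+s. ennreal (gamma_density a b s) * ennreal (gamma_density c b (r - s)) \<partial>lborel) =
           ennreal (gamma_density (a + c) b r)"
proof (cases "0 < r")
  case False
  then have "gamma_density a b s = 0 \<or> gamma_density c b (r - s) = 0" for s
    by (auto simp: gamma_density_def)
  then have "ennreal (gamma_density a b s) * ennreal (gamma_density c b (r - s)) = 0" for s
    by (metis ennreal_0 mult_zero_left mult_zero_right)
  then have "(\<integral>\<^sup>+s. ennreal (gamma_density a b s) * ennreal (gamma_density c b (r - s)) \<partial>lborel) = 0"
    by (simp only: nn_integral_const mult_zero_left)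
  moreover have "gamma_density (a + c) b r = 0" using False by (simp add: gamma_density_def)
  ultimately show ?thesis by simp
next
  case True
  have pos: "0 < Gamma a" "0 < Gamma c" "0 < Gamma (a + c)"
    using a c by (auto intro!: Gamma_real_pos)
  define K where "K = gamma_density (a + c) b r / Beta a c"
  have B: "0 < Beta a c" using pos by (simp add: Beta_def)
  have K: "0 \<le> K" using a c B by (simp add: K_def gamma_density_nonneg)
  have pw: "r * (r powr (a - 1) * r powr (c - 1)) = r powr (a + c - 1)"
    using True by (simp add: powr_add[symmetric] powr_mult_base)
  have "(\<integral>\<^sup>+s. ennreal (gamma_density a b s) * ennreal (gamma_density c b (r - s)) \<partial>lborel) =
      r * (\<integral>\<^sup>+t. ennreal (gamma_density a b (r * t)) * ennreal (gamma_density c b (r - r * t)) \<partial>lborel)"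
    using True by (subst nn_integral_real_affine[where c = r and t = 0]) auto
  also have "\<dots> = (\<integral>\<^sup>+t. ennreal r * (ennreal (gamma_density a b (r * t)) * ennreal (gamma_density c b (r - r * t))) \<partial>lborel)"
    by (simp add: nn_integral_cmult)
  also have "\<dots> = (\<integral>\<^sup>+t. ennreal K * ennreal (t powr (a - 1) * (1 - t) powr (c - 1) * indicator {0..1} t) \<partial>lborel)"
  proof (rule nn_integral_cong_AE)
    show "AE t in lborel. ennreal r * (ennreal (gamma_density a b (r * t)) * ennreal (gamma_density c b (r - r * t))) =
        ennreal K * ennreal (t powr (a - 1) * (1 - t) powr (c - 1) * indicator {0..1} t)"
      using AE_lborel_singleton[of 0] AE_lborel_singleton[of 1]
    proof eventually_elim
      fix t :: real assume t: "t \<noteq> 0" "t \<noteq> 1"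
      have "r * (gamma_density a b (r * t) * gamma_density c b (r - r * t)) =
          K * (t powr (a - 1) * (1 - t) powr (c - 1) * indicator {0..1} t)"
      proof (cases "0 < t \<and> t < 1")
        case T: True
        then have rt: "0 < r * t" "0 < r - r * t" using True by auto
        have e: "(r - r * t) powr (c - 1) = r powr (c - 1) * (1 - t) powr (c - 1)"
          using True T by (simp add: powr_mult[symmetric] algebra_simps)
        have "exp (- b * (r * t)) * exp (- b * (r - r * t)) = exp (- b * r)"
          by (simp add: exp_add[symmetric] algebra_simps)
        moreover have "b powr (a + c) = b powr a * b powr c" by (rule powr_add)
        moreover have "K = b powr (a + c) / (Gamma a * Gamma c) * r powr (a + c - 1) * exp (- b * r)"
          using True pos by (simp add: K_def gamma_density_def Beta_def)
        ultimately have K': "K = b powr a * b powr c / (Gamma a * Gamma c) * (r * (r powr (a - 1) * r powr (c - 1))) *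
             (exp (- b * (r * t)) * exp (- b * (r - r * t)))"
          by (simp only: pw)
        show ?thesis using T rt True unfolding K' by (simp add: gamma_density_def e powr_mult)
      next
        case F: False
        have "\<not> (0 < r * t \<and> 0 < r - r * t)"
        proof
          assume "0 < r * t \<and> 0 < r - r * t"
          then have "0 < t" "0 < r * (1 - t)" using True by (auto simp: zero_less_mult_iff algebra_simps)
          then show False using F True by (auto simp: zero_less_mult_iff)
        qed
        then show ?thesis using F t by (auto simp: gamma_density_def indicator_def)
      qed
      then show "ennreal r * (ennreal (gamma_density a b (r * t)) * ennreal (gamma_density c b (r - r * t))) =
          ennreal K * ennreal (t powr (a - 1) * (1 - t) powr (c - 1) * indicator {0..1} t)"
        using True K gamma_density_nonneg[OF a] gamma_density_nonneg[OF c]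
        by (simp add: ennreal_mult'[symmetric])
    qed
  qed
  also have "\<dots> = ennreal K * ennreal (Beta a c)"
    by (simp add: nn_integral_cmult nn_integral_Beta[OF a c])
  also have "\<dots> = ennreal (gamma_density (a + c) b r)"
    using K B by (simp add: ennreal_mult'[symmetric] K_def)
  finally show ?thesis .
qed

lemma Gamma_reflection_real:
  fixes a :: real
  shows "Gamma a * Gamma (1 - a) = pi / sin (pi * a)"
proof -
  have "of_real (Gamma a * Gamma (1 - a)) = (of_real (pi / sin (pi * a)) :: complex)"
    using Gamma_reflection_complex[of "of_real a"]
    by (simp add: Gamma_complex_of_real[symmetric] sin_of_real[symmetric])
  then show ?thesis by (simp only: of_real_eq_iff)
qed

text \<open>
  The Moebius transformation \<open>g\<close> below maps the interval \<open>[0, w]\<close> onto \<open>[0, 1]\<close> and absorbs the factor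
  \<open>1 / (x + v)\<close>; what remains is the Beta integral with parameters \<open>1 - a\<close> and \<open>a\<close>.
\<close>

lemma nn_integral_beta_stieltjes:
  assumes a: "0 < a" "a < 1" and x: "0 < x" and w: "0 < w"
  shows "(\<integral>\<^sup>+v. ennreal (v powr (- a) * (w - v) powr (a - 1) / (x + v) * indicator {0..w} v) \<partial>lborel) =
           ennreal (pi / sin (pi * a) * x powr (- a) * (x + w) powr (a - 1))"
proof -
  define f where "f t = t powr (- a) * (1 - t) powr (a - 1)" for t :: real
  define g where "g v = v * (x + w) / (w * (x + v))" for v
  define g' where "g' v = x * (x + w) / (w * (x + v)\<^sup>2)" for v
  define K where "K = x powr a * (x + w) powr (1 - a)"
  have K: "0 < K" using x w by (simp add: K_def)
  have ends: "g 0 = 0" "g w = 1" using x w by (simp_all add: g_def)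
  have der: "(g has_real_derivative g' v) (at v)" if "v \<in> {0..w}" for v
    unfolding g_def g'_def using that x w
    by (auto intro!: derivative_eq_intros simp: power2_eq_square divide_simps) (simp add: algebra_simps)
  have "ennreal (Gamma (1 - a) * Gamma a) = ennreal (Beta (1 - a) a)"
    by (simp add: Beta_def Gamma_1)
  also have "\<dots> = (\<integral>\<^sup>+t. ennreal (t powr (1 - a - 1) * (1 - t) powr (a - 1) * indicator {0..1} t) \<partial>lborel)"
    using a by (intro nn_integral_Beta[symmetric]) auto
  also have "\<dots> = (\<integral>\<^sup>+t. ennreal (f t * indicator {g 0..g w} t) \<partial>lborel)"
    unfolding ends f_def by simp
  also have "\<dots> = (\<integral>\<^sup>+v. ennreal (f (g v) * g' v * indicator {0..w} v) \<partial>lborel)"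
  proof (rule nn_integral_substitution)
    show "set_borel_measurable borel {g 0..g w} f"
      unfolding f_def set_borel_measurable_def by measurable
    show "continuous_on {0..w} g'"
      unfolding g'_def using x w by (auto intro!: continuous_intros)
    show "0 \<le> g' v" if "v \<in> {0..w}" for v using x w by (simp add: g'_def)
  qed (use w der in auto)
  also have "\<dots> = (\<integral>\<^sup>+v. ennreal K * ennreal (v powr (- a) * (w - v) powr (a - 1) / (x + v) * indicator {0..w} v) \<partial>lborel)"
  proof (rule nn_integral_cong_AE)
    show "AE v in lborel. ennreal (f (g v) * g' v * indicator {0..w} v) =
        ennreal K * ennreal (v powr (- a) * (w - v) powr (a - 1) / (x + v) * indicator {0..w} v)"
      using AE_lborel_singleton[of 0] AE_lborel_singleton[of w]
    proof eventually_elim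
      fix v :: real assume v0: "v \<noteq> 0" "v \<noteq> w"
      have "f (g v) * g' v = K * (v powr (- a) * (w - v) powr (a - 1) / (x + v))" if "v \<in> {0..w}"
      proof -
        have v: "0 < v" "v < w" "0 < w - v" "0 < x + v" "0 < x + w" using v0 that x w by auto
        have g1: "1 - g v = x * (w - v) / (w * (x + v))"
          using v x w by (simp add: g_def divide_simps) (simp add: algebra_simps)
        have "f (g v) = v powr (- a) * (x + w) powr (- a) / (w powr (- a) * (x + v) powr (- a)) *
            (x powr (a - 1) * (w - v) powr (a - 1) / (w powr (a - 1) * (x + v) powr (a - 1)))"
          unfolding f_def g1 unfolding g_def using v x w by (simp add: powr_mult powr_divide)
        also have "\<dots> = v powr (- a) * (x + w) powr (- a) * (x powr (a - 1) * (w - v) powr (a - 1)) * w * (x + v)"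
        proof -
          have e: "w powr (- a) = 1 / w powr a" "w powr (a - 1) = w powr a / w"
            "(x + v) powr (- a) = 1 / (x + v) powr a" "(x + v) powr (a - 1) = (x + v) powr a / (x + v)"
            using v w by (simp_all add: powr_minus_divide powr_diff)
          have "w powr a \<noteq> 0" "(x + v) powr a \<noteq> 0" using v w by auto
          then show ?thesis unfolding e using v w by (simp add: divide_simps)
        qed
        finally have "f (g v) * g' v = x powr (a - 1) * x * ((x + w) powr (- a) * (x + w)) *
            (v powr (- a) * (w - v) powr (a - 1) / (x + v))"
          using v w unfolding g'_def power2_eq_square by simp
        also have "x powr (a - 1) * x = x powr a" using x by (simp add: powr_mult_base mult.commute)
        also have "(x + w) powr (- a) * (x + w) = (x + w) powr (1 - a)"
          using v by (simp add: powr_mult_base mult.commute)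
        finally show ?thesis by (simp only: K_def)
      qed
      then show "ennreal (f (g v) * g' v * indicator {0..w} v) =
        ennreal K * ennreal (v powr (- a) * (w - v) powr (a - 1) / (x + v) * indicator {0..w} v)"
        using K by (simp add: ennreal_mult'[symmetric] indicator_def)
    qed
  qed
  also have "\<dots> = ennreal K * (\<integral>\<^sup>+v. ennreal (v powr (- a) * (w - v) powr (a - 1) / (x + v) * indicator {0..w} v) \<partial>lborel)"
    by (simp add: nn_integral_cmult)
  finally have *: "ennreal (Gamma (1 - a) * Gamma a) = ennreal K * (\<integral>\<^sup>+v. ennreal (v powr (- a) * (w - v) powr (a - 1) / (x + v) * indicator {0..w} v) \<partial>lborel)" .
  have "Gamma (1 - a) * Gamma a = K * (pi / sin (pi * a) * x powr (- a) * (x + w) powr (a - 1))"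
  proof -
    have "x powr a * x powr (- a) = 1" "(x + w) powr (1 - a) * (x + w) powr (a - 1) = 1"
      using x w by (simp_all add: powr_add[symmetric])
    then have "K * (x powr (- a) * (x + w) powr (a - 1)) = 1"
      unfolding K_def by (metis mult.assoc mult.left_commute mult_1)
    then have "K * (pi / sin (pi * a) * x powr (- a) * (x + w) powr (a - 1)) = pi / sin (pi * a)"
      by (metis mult.assoc mult.left_commute mult_1_right)
    then show ?thesis using Gamma_reflection_real[of a] by (simp add: mult.commute)
  qed
  with * have "ennreal K * (\<integral>\<^sup>+v. ennreal (v powr (- a) * (w - v) powr (a - 1) / (x + v) * indicator {0..w} v) \<partial>lborel) =
      ennreal K * ennreal (pi / sin (pi * a) * x powr (- a) * (x + w) powr (a - 1))"
    using K by (simp add: ennreal_mult'[symmetric])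
  then show ?thesis using K by (simp add: ennreal_mult_cancel_left)
qed

section \<open>The Gamma difference kernel and the overshoot density\<close>

lemma nn_integral_gamma_measure:
  "f \<in> borel_measurable borel \<Longrightarrow>
     (\<integral>\<^sup>+s. f s \<partial>gamma_measure a b) = (\<integral>\<^sup>+s. ennreal (gamma_density a b s) * f s \<partial>lborel)"
  unfolding gamma_measure_def by (rule nn_integral_density) measurable

text \<open>
  Exponential tilting changes the rate of a Gamma distribution: the second exponential in
  the next lemma turns the rate \<open>b\<close> into \<open>2 b\<close>.
\<close>

lemma gamma_density_tilt:
  assumes "0 < b"
  shows "gamma_density a b t * exp (- b * t) = 2 powr (- a) * gamma_density a (2 * b) t"
proof (cases "0 < t")
  case True
  have "exp (- b * t) * exp (- b * t) = exp (- (2 * b) * t)" by (simp add: exp_add[symmetric])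
  moreover have "2 powr (- a) * (2 * b) powr a = b powr a"
    using assms by (simp add: powr_mult powr_minus)
  ultimately show ?thesis using True
    by (simp add: gamma_density_def)
qed (simp add: gamma_density_def)

text \<open>
  Adding the positive Gamma variable first turns the density with shape \<open>1 - a\<close> into one with shape 1,
  that is, an exponential function cut off at \<open>y\<close>.  Subtracting the second variable then tilts its density and leaves a tail.
\<close>

lemma nn_integral_gamma_difference_kernel:
  assumes a: "0 < a" "a < 1" and b: "0 < b"
  shows "(\<integral>\<^sup>+v. ennreal (gamma_density (1 - a) b (y - (u + v))) \<partial>gamma_difference a b) =
           ennreal (b * 2 powr (- a) * exp (b * (u - y))) * emeasure (gamma_measure a (2 * b)) {u - y<..}"
proof -
  let ?G = "gamma_measure a b"
  interpret G: real_distribution ?G using a b by (intro real_distribution_gamma)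
  have "(\<integral>\<^sup>+v. ennreal (gamma_density (1 - a) b (y - (u + v))) \<partial>gamma_difference a b) =
      (\<integral>\<^sup>+p. (\<lambda>(t, s). ennreal (gamma_density (1 - a) b (y - (u + (s - t))))) p \<partial>(?G \<Otimes>\<^sub>M ?G))"
    unfolding gamma_difference_def by (subst nn_integral_distr) (auto simp: split_beta')
  also have "\<dots> = (\<integral>\<^sup>+t. \<integral>\<^sup>+s. ennreal (gamma_density (1 - a) b (y - (u + (s - t)))) \<partial>?G \<partial>?G)"
    by (subst G.nn_integral_fst[symmetric]) auto
  also have "\<dots> = (\<integral>\<^sup>+t. ennreal (gamma_density 1 b (y - u + t)) \<partial>?G)"
  proof (intro nn_integral_cong)
    fix t
    have "(\<integral>\<^sup>+s. ennreal (gamma_density (1 - a) b (y - (u + (s - t)))) \<partial>?G) =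
      (\<integral>\<^sup>+s. ennreal (gamma_density a b s) * ennreal (gamma_density (1 - a) b ((y - u + t) - s)) \<partial>lborel)"
      by (subst nn_integral_gamma_measure) (auto simp: algebra_simps)
    also have "\<dots> = ennreal (gamma_density (a + (1 - a)) b (y - u + t))"
      using a b by (intro gamma_density_convolution) auto
    finally show "(\<integral>\<^sup>+s. ennreal (gamma_density (1 - a) b (y - (u + (s - t)))) \<partial>?G) =
      ennreal (gamma_density 1 b (y - u + t))" by simp
  qed
  also have "\<dots> = (\<integral>\<^sup>+t. ennreal (gamma_density a b t) * ennreal (gamma_density 1 b (y - u + t)) \<partial>lborel)"
    by (subst nn_integral_gamma_measure) auto
  also have "\<dots> = (\<integral>\<^sup>+t. ennreal (b * 2 powr (- a) * exp (b * (u - y))) *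
      (ennreal (gamma_density a (2 * b) t) * indicator {u - y<..} t) \<partial>lborel)"
  proof (intro nn_integral_cong)
    fix t
    show "ennreal (gamma_density a b t) * ennreal (gamma_density 1 b (y - u + t)) =
      ennreal (b * 2 powr (- a) * exp (b * (u - y))) * (ennreal (gamma_density a (2 * b) t) * indicator {u - y<..} t)"
    proof (cases "u - y < t")
      case True
      then have "gamma_density 1 b (y - u + t) = b * exp (b * (u - y)) * exp (- b * t)"
        using b by (simp add: gamma_density_def exp_add[symmetric] algebra_simps)
      then have "gamma_density a b t * gamma_density 1 b (y - u + t) =
          b * exp (b * (u - y)) * (gamma_density a b t * exp (- b * t))" by simp
      also have "\<dots> = b * 2 powr (- a) * exp (b * (u - y)) * gamma_density a (2 * b) t"
        unfolding gamma_density_tilt[OF b] by simp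
      finally show ?thesis using True b gamma_density_nonneg[OF a(1)]
        by (simp add: ennreal_mult'[symmetric])
    qed (simp add: gamma_density_def)
  qed
  also have "\<dots> = ennreal (b * 2 powr (- a) * exp (b * (u - y))) * (\<integral>\<^sup>+t. ennreal (gamma_density a (2 * b) t) * indicator {u - y<..} t \<partial>lborel)"
    by (rule nn_integral_cmult) measurable
  also have "(\<integral>\<^sup>+t. ennreal (gamma_density a (2 * b) t) * indicator {u - y<..} t \<partial>lborel) = emeasure (gamma_measure a (2 * b)) {u - y<..}"
    unfolding gamma_measure_def by (rule emeasure_density[symmetric]) auto
  finally show ?thesis .
qed

lemma emeasure_gamma_tail:
  "emeasure (gamma_measure a b) {u - y<..} =
     (\<integral>\<^sup>+w. ennreal (gamma_density a b (u - w)) * indicator {..<y} w \<partial>lborel)"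
proof -
  have "emeasure (gamma_measure a b) {u - y<..} = (\<integral>\<^sup>+s. ennreal (gamma_density a b s) * indicator {u - y<..} s \<partial>lborel)"
    unfolding gamma_measure_def by (rule emeasure_density) auto
  also have "\<dots> = (\<integral>\<^sup>+w. ennreal (gamma_density a b (u - w)) * indicator {u - y<..} (u - w) \<partial>lborel)"
    by (subst nn_integral_real_affine[where c = "-1" and t = u]) auto
  also have "\<dots> = (\<integral>\<^sup>+w. ennreal (gamma_density a b (u - w)) * indicator {..<y} w \<partial>lborel)"
    by (intro nn_integral_cong) (auto simp: indicator_def)
  finally show ?thesis .
qed

definition overshoot_density :: "real \<Rightarrow> real \<Rightarrow> real \<Rightarrow> real \<Rightarrow> real" where
  "overshoot_density a b x u =
     (if u < 0 then sin (pi * a) / pi * (x / (- u)) powr a * (exp (- b * (x - u)) / (x - u)) else 0)"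

lemma borel_measurable_overshoot_density [measurable]: "overshoot_density a b x \<in> borel_measurable borel"
  unfolding overshoot_density_def by measurable

lemma overshoot_density_nonneg:
  assumes "0 < a" "a < 1" "0 < x"
  shows "0 \<le> overshoot_density a b x u"
  using assms sin_gt_zero[of "pi * a"] by (simp add: overshoot_density_def)

text \<open>
  The exponential factors combine to a constant in \<open>u\<close>, so that only the algebraic
  integral \<open>nn_integral_beta_stieltjes\<close> is left; the sine cancels against its value.
\<close>

lemma overshoot_density_convolution:
  assumes a: "0 < a" "a < 1" and b: "0 < b" and x: "0 < x" and w: "w < 0"
  shows "(\<integral>\<^sup>+u. ennreal (overshoot_density a b x u * exp (b * u)) * ennreal (gamma_density a (2 * b) (u - w)) \<partial>lborel) =
           ennreal (exp (b * x) * gamma_density a (2 * b) (x - w))"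
proof -
  define W where "W = - w"
  have W: "0 < W" using w by (simp add: W_def)
  have s: "0 < sin (pi * a)" using a by (intro sin_gt_zero) auto
  have G: "0 < Gamma a" using a by (intro Gamma_real_pos)
  define K where "K = sin (pi * a) / pi * x powr a * ((2 * b) powr a / Gamma a) * exp (- b * x - 2 * b * W)"
  have K: "0 \<le> K" using s G by (simp add: K_def)
  have "(\<integral>\<^sup>+u. ennreal (overshoot_density a b x u * exp (b * u)) * ennreal (gamma_density a (2 * b) (u - w)) \<partial>lborel) =
    (\<integral>\<^sup>+v. ennreal (overshoot_density a b x (- v) * exp (b * (- v))) * ennreal (gamma_density a (2 * b) (- v - w)) \<partial>lborel)"
    by (subst nn_integral_real_affine[where c = "-1" and t = 0]) auto
  also have "\<dots> = (\<integral>\<^sup>+v. ennreal K * ennreal (v powr (- a) * (W - v) powr (a - 1) / (x + v) * indicator {0..W} v) \<partial>lborel)"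
  proof (rule nn_integral_cong_AE)
    show "AE v in lborel. ennreal (overshoot_density a b x (- v) * exp (b * (- v))) * ennreal (gamma_density a (2 * b) (- v - w)) =
        ennreal K * ennreal (v powr (- a) * (W - v) powr (a - 1) / (x + v) * indicator {0..W} v)"
      using AE_lborel_singleton[of 0] AE_lborel_singleton[of W]
    proof eventually_elim
      fix v :: real assume v0: "v \<noteq> 0" "v \<noteq> W"
      have "overshoot_density a b x (- v) * exp (b * (- v)) * gamma_density a (2 * b) (- v - w) =
          K * (v powr (- a) * (W - v) powr (a - 1) / (x + v) * indicator {0..W} v)"
      proof (cases "0 < v \<and> v < W")
        case True
        then have v: "0 < v" "v < W" by auto
        have wv: "- v - w = W - v" by (simp add: W_def)
        have "exp (- b * (x + v)) * exp (b * (- v)) * exp (- (2 * b) * (- v - w)) = exp (- b * x - 2 * b * W)"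
          unfolding exp_add[symmetric] by (simp add: W_def algebra_simps)
        then have e: "K = sin (pi * a) / pi * x powr a * ((2 * b) powr a / Gamma a) *
            (exp (- b * (x + v)) * exp (b * (- v)) * exp (- (2 * b) * (- v - w)))"
          by (simp only: K_def)
        show ?thesis using v x unfolding e wv
          by (simp add: overshoot_density_def gamma_density_def powr_divide powr_minus_divide mult_ac)
      next
        case False
        then have "v < 0 \<or> W < v" using v0 by auto
        then show ?thesis by (auto simp: overshoot_density_def gamma_density_def W_def)
      qed
      then show "ennreal (overshoot_density a b x (- v) * exp (b * (- v))) * ennreal (gamma_density a (2 * b) (- v - w)) =
        ennreal K * ennreal (v powr (- a) * (W - v) powr (a - 1) / (x + v) * indicator {0..W} v)"
        using K overshoot_density_nonneg[OF a x] by (simp add: ennreal_mult'[symmetric])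
    qed
  qed
  also have "\<dots> = ennreal K * ennreal (pi / sin (pi * a) * x powr (- a) * (x + W) powr (a - 1))"
    unfolding nn_integral_beta_stieltjes[OF a x W, symmetric] by (rule nn_integral_cmult) measurable
  also have "\<dots> = ennreal (K * (pi / sin (pi * a) * x powr (- a) * (x + W) powr (a - 1)))"
    using K by (rule ennreal_mult'[symmetric])
  also have "K * (pi / sin (pi * a) * x powr (- a) * (x + W) powr (a - 1)) = exp (b * x) * gamma_density a (2 * b) (x - w)"
  proof -
    have "exp (- b * x - 2 * b * W) = exp (b * x) * exp (- (2 * b) * (x - w))"
      unfolding exp_add[symmetric] by (simp add: W_def algebra_simps)
    then show ?thesis using s x w
      by (simp add: K_def gamma_density_def W_def powr_minus_divide)
  qed
  finally show ?thesis .
qed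

text \<open>
  The tail is the integral of the Gamma density over \<open>w < y\<close>.  Since \<open>y \<le> 0\<close>, only
  negative \<open>w\<close> occur, and the previous convolution identity is integrated over them.
\<close>

lemma overshoot_density_potential:
  assumes a: "0 < a" "a < 1" and b: "0 < b" and x: "0 < x" and y: "y \<le> 0"
  shows "(\<integral>\<^sup>+u. ennreal (overshoot_density a b x u * exp (b * u)) * emeasure (gamma_measure a (2 * b)) {u - y<..} \<partial>lborel) =
           ennreal (exp (b * x)) * emeasure (gamma_measure a (2 * b)) {x - y<..}"
proof -
  have "(\<integral>\<^sup>+u. ennreal (overshoot_density a b x u * exp (b * u)) * emeasure (gamma_measure a (2 * b)) {u - y<..} \<partial>lborel) =
    (\<integral>\<^sup>+u. \<integral>\<^sup>+w. ennreal (overshoot_density a b x u * exp (b * u)) * (ennreal (gamma_density a (2 * b) (u - w)) * indicator {..<y} w) \<partial>lborel \<partial>lborel)"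
    unfolding emeasure_gamma_tail by (intro nn_integral_cong nn_integral_cmult[symmetric]) measurable
  also have "\<dots> = (\<integral>\<^sup>+w. \<integral>\<^sup>+u. ennreal (overshoot_density a b x u * exp (b * u)) * (ennreal (gamma_density a (2 * b) (u - w)) * indicator {..<y} w) \<partial>lborel \<partial>lborel)"
    by (rule lborel_pair.Fubini') measurable
  also have "\<dots> = (\<integral>\<^sup>+w. ennreal (exp (b * x)) * (ennreal (gamma_density a (2 * b) (x - w)) * indicator {..<y} w) \<partial>lborel)"
  proof (intro nn_integral_cong)
    fix w :: real
    have "(\<integral>\<^sup>+u. ennreal (overshoot_density a b x u * exp (b * u)) * (ennreal (gamma_density a (2 * b) (u - w)) * indicator {..<y} w) \<partial>lborel) =
      (\<integral>\<^sup>+u. ennreal (overshoot_density a b x u * exp (b * u)) * ennreal (gamma_density a (2 * b) (u - w)) \<partial>lborel) * indicator {..<y} w"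
      by (subst nn_integral_multc[symmetric]) (auto simp: mult.assoc)
    also have "\<dots> = ennreal (exp (b * x)) * (ennreal (gamma_density a (2 * b) (x - w)) * indicator {..<y} w)"
      using y overshoot_density_convolution[OF a b x, of w] gamma_density_nonneg[OF a(1)]
      by (auto simp: indicator_def ennreal_mult')
    finally show "(\<integral>\<^sup>+u. ennreal (overshoot_density a b x u * exp (b * u)) * (ennreal (gamma_density a (2 * b) (u - w)) * indicator {..<y} w) \<partial>lborel) =
      ennreal (exp (b * x)) * (ennreal (gamma_density a (2 * b) (x - w)) * indicator {..<y} w)" .
  qed
  also have "\<dots> = ennreal (exp (b * x)) * emeasure (gamma_measure a (2 * b)) {x - y<..}"
    unfolding emeasure_gamma_tail by (rule nn_integral_cmult) measurable
  finally show ?thesis .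
qed

section \<open>First passage of right-continuous paths along dyadic grids\<close>

definition right_continuous :: "(real \<Rightarrow> real) \<Rightarrow> bool" where
  "right_continuous f \<longleftrightarrow> (\<forall>t\<ge>0. continuous (at_right t) f)"

lemma right_continuous_seq:
  assumes f: "right_continuous f" and t: "0 \<le> t" and s: "\<And>n. t \<le> s n" "s \<longlonglongrightarrow> t"
  shows "(\<lambda>n. f (s n)) \<longlonglongrightarrow> f t"
proof -
  have "at t within {t..} = at_right t"
    unfolding at_within_def by (rule arg_cong2[where f=inf] refl arg_cong[where f=principal])+ auto
  then have "continuous (at t within {t..}) f"
    using f t by (simp add: right_continuous_def)
  then show ?thesis
    using s unfolding continuous_within_sequentially by (auto simp: o_def)
qed

text \<open>
  The index of the first point of the grid with mesh \<open>1 / 2 ^ n\<close> that lies strictly after \<open>t\<close>.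
\<close>

definition grid_above :: "nat \<Rightarrow> real \<Rightarrow> nat" where
  "grid_above n t = Suc (nat \<lfloor>t * 2 ^ n\<rfloor>)"

lemma grid_above:
  assumes "0 \<le> t"
  shows "t < grid_above n t / 2 ^ n" "grid_above n t / 2 ^ n \<le> t + (1 / 2) ^ n"
proof -
  have "real (nat \<lfloor>t * 2 ^ n\<rfloor>) = of_int \<lfloor>t * 2 ^ n\<rfloor>" using assms by simp
  then have "t * 2 ^ n < grid_above n t" "grid_above n t \<le> t * 2 ^ n + 1"
    unfolding grid_above_def by linarith+
  then show "t < grid_above n t / 2 ^ n" "grid_above n t / 2 ^ n \<le> t + (1 / 2) ^ n"
    by (auto simp: field_simps power_divide)
qed

lemma grid_above_tendsto:
  assumes "0 \<le> t" shows "(\<lambda>n. grid_above n t / 2 ^ n) \<longlonglongrightarrow> t"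
proof (rule tendsto_sandwich)
  show "\<forall>\<^sub>F n in sequentially. t \<le> grid_above n t / 2 ^ n"
    "\<forall>\<^sub>F n in sequentially. grid_above n t / 2 ^ n \<le> t + (1 / 2) ^ n"
    using grid_above[OF assms] by (auto intro!: always_eventually less_imp_le)
  have "(\<lambda>n. t + (1 / 2 :: real) ^ n) \<longlonglongrightarrow> t + 0"
    by (intro tendsto_intros LIMSEQ_power_zero) auto
  then show "(\<lambda>n. t + (1 / 2 :: real) ^ n) \<longlonglongrightarrow> t" by simp
qed auto

definition goes_negative :: "(real \<Rightarrow> real) \<Rightarrow> bool" where
  "goes_negative f \<longleftrightarrow> (\<exists>t\<ge>0. f t < 0)"

text \<open>
  The value 0 for paths that stay nonnegative makes this a limit of its grid approximations for every
  right-continuous path; whether the path becomes negative is recorded separately.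
\<close>

definition first_negative :: "(real \<Rightarrow> real) \<Rightarrow> real" where
  "first_negative f = (if goes_negative f then Inf {t. 0 \<le> t \<and> f t < 0} else 0)"

definition grid_negative :: "nat \<Rightarrow> (real \<Rightarrow> real) \<Rightarrow> bool" where
  "grid_negative n f \<longleftrightarrow> (\<exists>k::nat. f (k / 2 ^ n) < 0)"

definition grid_first_index :: "nat \<Rightarrow> (real \<Rightarrow> real) \<Rightarrow> nat" where
  "grid_first_index n f = (if grid_negative n f then LEAST k. f (real k / 2 ^ n) < 0 else 0)"

abbreviation grid_first_negative :: "nat \<Rightarrow> (real \<Rightarrow> real) \<Rightarrow> real" where
  "grid_first_negative n f \<equiv> grid_first_index n f / 2 ^ n"

lemma grid_first_negative_neg: "grid_negative n f \<Longrightarrow> f (grid_first_negative n f) < 0"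
  unfolding grid_first_index_def grid_negative_def by (auto intro: LeastI_ex)

lemma grid_first_negative_le: "f (real k / 2 ^ n) < 0 \<Longrightarrow> grid_first_negative n f \<le> k / 2 ^ n"
  by (auto simp: grid_first_index_def grid_negative_def intro!: divide_right_mono Least_le)

lemma first_negative_nonneg: "0 \<le> first_negative f"
  unfolding first_negative_def goes_negative_def by (auto intro!: cInf_greatest)

lemma first_negative_le:
  assumes "0 \<le> t" "f t < 0" shows "first_negative f \<le> t"
proof -
  have "bdd_below {t. 0 \<le> t \<and> f t < 0}" by (auto intro!: bdd_belowI[of _ 0])
  then show ?thesis using assms by (auto simp: first_negative_def goes_negative_def intro!: cInf_lower)
qed

lemma grid_negative_imp: "grid_negative n f \<Longrightarrow> goes_negative f"
  unfolding grid_negative_def goes_negative_def by (metis divide_nonneg_nonneg of_nat_0_le_iff zero_le_numeral zero_le_power)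

lemma first_negative_le_grid: "grid_negative n f \<Longrightarrow> first_negative f \<le> grid_first_negative n f"
  by (intro first_negative_le grid_first_negative_neg) auto

lemma grid_above_eventually_negative:
  assumes f: "right_continuous f" and t: "0 \<le> t" "f t < 0"
  shows "\<forall>\<^sub>F n in sequentially. f (grid_above n t / 2 ^ n) < 0"
proof -
  have "(\<lambda>n. f (grid_above n t / 2 ^ n)) \<longlonglongrightarrow> f t"
    using grid_above[OF t(1)] by (intro right_continuous_seq[OF f t(1)] grid_above_tendsto t) (auto intro: less_imp_le)
  then show ?thesis using t(2) by (rule order_tendstoD)
qed

lemma eventually_grid_negative:
  assumes f: "right_continuous f" and neg: "goes_negative f"
  shows "\<forall>\<^sub>F n in sequentially. grid_negative n f"
proof -
  obtain t where t: "0 \<le> t" "f t < 0" using neg by (auto simp: goes_negative_def)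
  show ?thesis
    using grid_above_eventually_negative[OF f t] by eventually_elim (auto simp: grid_negative_def)
qed

text \<open>
  By right-continuity a path that is negative at \<open>t\<close> is still negative at the grid point following \<open>t\<close> when the grid is
  fine, so the grid does not miss the first passage by much.
\<close>

lemma grid_first_negative_tendsto:
  assumes f: "right_continuous f"
  shows "(\<lambda>n. grid_first_negative n f) \<longlonglongrightarrow> first_negative f"
proof (cases "goes_negative f")
  case neg: True
  show ?thesis
  proof (rule order_tendstoI)
    fix c assume "c < first_negative f"
    then show "\<forall>\<^sub>F n in sequentially. c < grid_first_negative n f"
      using eventually_grid_negative[OF f neg] by (auto elim!: eventually_mono dest: first_negative_le_grid)
  next
    fix c assume c: "first_negative f < c"
    then have lt: "Inf {t. 0 \<le> t \<and> f t < 0} < c" using neg by (simp add: first_negative_def)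
    have ne: "{t. 0 \<le> t \<and> f t < 0} \<noteq> {}" using neg by (auto simp: goes_negative_def)
    obtain t where t: "0 \<le> t" "f t < 0" "t < c" using cInf_lessD[OF ne lt] by auto
    have "\<forall>\<^sub>F n in sequentially. grid_above n t / 2 ^ n < c"
      using grid_above_tendsto[OF t(1)] t(3) by (rule order_tendstoD)
    with grid_above_eventually_negative[OF f t(1,2)]
    show "\<forall>\<^sub>F n in sequentially. grid_first_negative n f < c"
      by eventually_elim (meson grid_first_negative_le le_less_trans)
  qed
next
  case False
  then have "\<not> grid_negative n f" for n using grid_negative_imp by blast
  with False show ?thesis by (simp add: first_negative_def grid_first_index_def)
qed

lemma value_grid_first_negative_tendsto:
  assumes f: "right_continuous f"
  shows "(\<lambda>n. f (grid_first_negative n f)) \<longlonglongrightarrow> f (first_negative f)"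
proof (cases "goes_negative f")
  case neg: True
  let ?s = "\<lambda>n. max (first_negative f) (grid_first_negative n f)"
  have "?s \<longlonglongrightarrow> max (first_negative f) (first_negative f)"
    by (intro tendsto_intros grid_first_negative_tendsto f)
  then have "(\<lambda>n. f (?s n)) \<longlonglongrightarrow> f (first_negative f)"
    by (intro right_continuous_seq[OF f first_negative_nonneg]) auto
  moreover have "\<forall>\<^sub>F n in sequentially. f (?s n) = f (grid_first_negative n f)"
    using eventually_grid_negative[OF f neg] by eventually_elim (simp add: max_absorb2 first_negative_le_grid)
  ultimately show ?thesis by (rule Lim_transform_eventually)
next
  case False
  then have "\<not> grid_negative n f" for n using grid_negative_imp by blast
  with False show ?thesis by (simp add: first_negative_def grid_first_index_def)
qed

lemma value_first_negative_nonpos: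
  assumes f: "right_continuous f" and neg: "goes_negative f"
  shows "f (first_negative f) \<le> 0"
proof (rule tendsto_upperbound[OF value_grid_first_negative_tendsto[OF f]])
  show "\<forall>\<^sub>F n in sequentially. f (grid_first_negative n f) \<le> 0"
    using eventually_grid_negative[OF f neg] by eventually_elim (auto dest: grid_first_negative_neg)
qed simp

lemma grid_first_negative_before:
  assumes f: "right_continuous f" and t: "0 \<le> t" "f t < 0" and s: "first_negative f < s"
  shows "\<exists>n. grid_negative n f \<and> grid_first_negative n f \<le> s"
proof -
  have "goes_negative f" using t by (auto simp: goes_negative_def)
  note eventually_grid_negative[OF f this]
  moreover have "\<forall>\<^sub>F n in sequentially. grid_first_negative n f < s"
    using grid_first_negative_tendsto[OF f] s by (rule order_tendstoD)
  ultimately have "\<forall>\<^sub>F n in sequentially. grid_negative n f \<and> grid_first_negative n f \<le> s"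
    by eventually_elim auto
  then show ?thesis using eventually_happens'[OF sequentially_bot] by blast
qed

text \<open>
  Dyadic grids are nested, which makes the approximating times monotone.
\<close>

lemma grid_refine:
  assumes "grid_negative n f"
  shows "grid_negative (Suc n) f" "grid_first_negative (Suc n) f \<le> grid_first_negative n f"
proof -
  have e: "grid_first_negative n f = real (2 * grid_first_index n f) / 2 ^ Suc n" by simp
  have *: "f (real (2 * grid_first_index n f) / 2 ^ Suc n) < 0"
    using grid_first_negative_neg[OF assms] by (simp only: e)
  then show "grid_negative (Suc n) f" unfolding grid_negative_def by blast
  show "grid_first_negative (Suc n) f \<le> grid_first_negative n f"
  proof -
    have "grid_first_negative (Suc n) f \<le> real (2 * grid_first_index n f) / 2 ^ Suc n"
      by (rule grid_first_negative_le) (rule *)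
    then show ?thesis unfolding e[symmetric] .
  qed
qed

definition grid_first_at :: "nat \<Rightarrow> nat \<Rightarrow> (real \<Rightarrow> real) \<Rightarrow> bool" where
  "grid_first_at n k f \<longleftrightarrow> f (real k / 2 ^ n) < 0 \<and> (\<forall>j<k. \<not> f (real j / 2 ^ n) < 0)"

lemma grid_first_at_iff: "grid_first_at n k f \<longleftrightarrow> grid_negative n f \<and> grid_first_index n f = k"
proof
  assume *: "grid_first_at n k f"
  then have "(LEAST k. f (real k / 2 ^ n) < 0) = k"
    by (intro Least_equality) (auto simp: grid_first_at_def intro: leI)
  then show "grid_negative n f \<and> grid_first_index n f = k"
    using * by (auto simp: grid_first_at_def grid_first_index_def grid_negative_def)
next
  assume *: "grid_negative n f \<and> grid_first_index n f = k"
  then have "grid_negative n f" "grid_first_index n f = k" by auto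
  then have "k = (LEAST k. f (real k / 2 ^ n) < 0)" unfolding grid_first_index_def by simp
  moreover have "f (real k / 2 ^ n) < 0" using grid_first_negative_neg[of n f] * by auto
  ultimately show "grid_first_at n k f"
    unfolding grid_first_at_def using not_less_Least by blast
qed

lemma suminf_grid_first_at:
  fixes F :: "nat \<Rightarrow> ennreal"
  shows "(\<Sum>k. (if grid_first_at n k f then F k else 0)) = (if grid_negative n f then F (grid_first_index n f) else 0)"
proof (cases "grid_negative n f")
  case True
  then have "(\<lambda>k. if grid_first_at n k f then F k else 0) = (\<lambda>k. if k = grid_first_index n f then F k else 0)"
    by (auto simp: grid_first_at_iff fun_eq_iff)
  then show ?thesis using sums_single[of "grid_first_index n f" F] True by (simp add: sums_iff)
qed (simp add: grid_first_at_iff)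

section \<open>The process at an exponential time\<close>

text \<open>
  The paths are right-continuous and start in 0 without exceptional sets.  Every process of the
  theorem agrees almost surely with such a version.
\<close>

locale regular_relativistic_process = relativistic_stable_process M X \<alpha> m
  for M :: "'w measure" and X :: "real \<Rightarrow> 'w \<Rightarrow> real" and \<alpha> m :: real +
  assumes alpha: "0 < \<alpha>" "\<alpha> < 2" and m_pos: "0 < m"
    and start: "\<And>\<omega>. X 0 \<omega> = 0"
    and paths: "\<And>\<omega>. right_continuous (\<lambda>t. X t \<omega>)"

text \<open>
  Independence is a statement about the joint law, which does not see null sets.
\<close>

lemma (in prob_space) indep_vars_cong_AE:
  fixes X Y :: "'i \<Rightarrow> 'a \<Rightarrow> 'b"
  assumes "I \<noteq> {}" "finite I" and X: "indep_vars M' X I"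
    and Y: "\<And>i. i \<in> I \<Longrightarrow> random_variable (M' i) (Y i)"
    and eq: "\<And>i. i \<in> I \<Longrightarrow> AE \<omega> in M. Y i \<omega> = X i \<omega>"
  shows "indep_vars M' Y I"
proof -
  have rvX: "random_variable (M' i) (X i)" if "i \<in> I" for i
    using X that by (auto simp: indep_vars_def)
  have "AE \<omega> in M. \<forall>i\<in>I. Y i \<omega> = X i \<omega>"
    using assms(2) eq by (intro AE_finite_allI)
  then have "distr M (\<Pi>\<^sub>M i\<in>I. M' i) (\<lambda>x. \<lambda>i\<in>I. Y i x) = distr M (\<Pi>\<^sub>M i\<in>I. M' i) (\<lambda>x. \<lambda>i\<in>I. X i x)"
    using rvX Y by (intro distr_cong_AE measurable_restrict) (auto elim!: eventually_mono simp: restrict_def)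
  also have "\<dots> = (\<Pi>\<^sub>M i\<in>I. distr M (M' i) (X i))"
    using indep_vars_iff_distr_eq_PiM'[OF assms(1) rvX] X by simp
  also have "\<dots> = (\<Pi>\<^sub>M i\<in>I. distr M (M' i) (Y i))"
  proof (intro PiM_cong refl distr_cong_AE)
    show "AE \<omega> in M. X i \<omega> = Y i \<omega>" if "i \<in> I" for i
      using eq[OF that] by eventually_elim simp
  qed (use rvX Y in auto)
  finally show ?thesis
    using indep_vars_iff_distr_eq_PiM'[OF assms(1) Y] by simp
qed

text \<open>
  On a measurable null set that contains all irregular paths, the process is replaced by 0.
\<close>

lemma regular_version:
  assumes X: "relativistic_stable_process M X \<alpha> m" and par: "0 < \<alpha>" "\<alpha> < 2" "0 < m"
  obtains X' where "regular_relativistic_process M X' \<alpha> m" "AE \<omega> in M. \<forall>t. X' t \<omega> = X t \<omega>"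
proof -
  interpret relativistic_stable_process M X \<alpha> m by fact
  have "AE \<omega> in M. X 0 \<omega> = 0 \<and> cadlag (\<lambda>t. X t \<omega>)"
    using start_zero cadlag_paths by eventually_elim auto
  then obtain N where N: "{\<omega> \<in> space M. \<not> (X 0 \<omega> = 0 \<and> cadlag (\<lambda>t. X t \<omega>))} \<subseteq> N"
      "emeasure M N = 0" "N \<in> sets M"
    by (rule AE_E)
  define X' where "X' t \<omega> = (if \<omega> \<in> space M - N then X t \<omega> else 0)" for t \<omega>
  have "AE \<omega> in M. \<omega> \<notin> N"
    using N by (intro AE_not_in) (auto simp: null_sets_def)
  then have ae: "AE \<omega> in M. \<forall>t. X' t \<omega> = X t \<omega>"
    by (intro AE_I'[of N]) (auto simp: X'_def null_sets_def N)
  have rv: "X' t \<in> borel_measurable M" if "0 \<le> t" for t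
    unfolding X'_def using N(3) random_variable[OF that] by measurable
  have "regular_relativistic_process M X' \<alpha> m"
  proof unfold_locales
    fix t :: real assume "0 \<le> t" then show "X' t \<in> borel_measurable M" by (rule rv)
  next
    show "AE \<omega> in M. X' 0 \<omega> = 0"
      using ae start_zero by eventually_elim auto
  next
    fix n :: nat and t :: "nat \<Rightarrow> real"
    assume t: "0 \<le> t 0" "\<forall>i<n. t i \<le> t (Suc i)"
    show "indep_vars (\<lambda>_. borel) (\<lambda>i \<omega>. X' (t (Suc i)) \<omega> - X' (t i) \<omega>) {..<n}"
    proof (cases "n = 0")
      case True
      then show ?thesis by (simp add: indep_vars_def indep_sets_def)
    next
      case False
      have tn: "0 \<le> t i" if "i \<le> n" for i
        using that by (induction i) (use t in \<open>auto intro: order_trans\<close>)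
      show ?thesis
      proof (rule indep_vars_cong_AE[OF _ _ independent_increments[OF t]])
        show "AE \<omega> in M. X' (t (Suc i)) \<omega> - X' (t i) \<omega> = X (t (Suc i)) \<omega> - X (t i) \<omega>" for i
          using ae by eventually_elim simp
        show "(\<lambda>\<omega>. X' (t (Suc i)) \<omega> - X' (t i) \<omega>) \<in> borel_measurable M" if "i \<in> {..<n}" for i
          using that by (intro borel_measurable_diff rv tn) auto
      qed (use False in auto)
    qed
  next
    fix s t :: real assume st: "0 \<le> s" "0 \<le> t"
    have "distr M borel (\<lambda>\<omega>. X' (s + t) \<omega> - X' s \<omega>) = distr M borel (\<lambda>\<omega>. X (s + t) \<omega> - X s \<omega>)"
      using ae st by (intro distr_cong_AE borel_measurable_diff rv random_variable) (auto elim!: eventually_mono)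
    also have "\<dots> = distr M borel (\<lambda>\<omega>. X t \<omega> - X 0 \<omega>)" by (rule stationary_increments[OF st])
    also have "\<dots> = distr M borel (\<lambda>\<omega>. X' t \<omega> - X' 0 \<omega>)"
      using ae st by (intro distr_cong_AE borel_measurable_diff rv random_variable) (auto elim!: eventually_mono)
    finally show "distr M borel (\<lambda>\<omega>. X' (s + t) \<omega> - X' s \<omega>) = distr M borel (\<lambda>\<omega>. X' t \<omega> - X' 0 \<omega>)" .
  next
    show "AE \<omega> in M. cadlag (\<lambda>t. X' t \<omega>)"
      using ae cadlag_paths by eventually_elim simp
  next
    fix t z :: real assume t: "0 \<le> t"
    have "distr M borel (X' t) = distr M borel (X t)"
      using ae t by (intro distr_cong_AE rv random_variable) (auto elim!: eventually_mono)
    then show "char (distr M borel (X' t)) z = complex_of_real (exp (m * t) * exp (- t * (\<bar>z\<bar>\<^sup>2 + m powr (2 / \<alpha>)) powr (\<alpha> / 2)))"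
      using char_relativistic[OF t] by simp
  next
    show "X' 0 \<omega> = 0" for \<omega> using N(1) by (auto simp: X'_def)
    show "right_continuous (\<lambda>t. X' t \<omega>)" for \<omega>
    proof (cases "\<omega> \<in> space M - N")
      case True
      then have "cadlag (\<lambda>t. X t \<omega>)" using N(1) by auto
      then show ?thesis using True by (simp add: right_continuous_def cadlag_def X'_def)
    next
      case False
      then have "(\<lambda>t. X' t \<omega>) = (\<lambda>_. 0)" by (auto simp: X'_def)
      then show ?thesis by (simp add: right_continuous_def)
    qed
  qed (fact par)+
  with ae show ?thesis by (intro that)
qed

context regular_relativistic_process
begin

lemma X_measurable [measurable]: "X (max 0 t) \<in> borel_measurable M"
  by (rule random_variable) simp

lemma X_grid_measurable [measurable]: "X (real k / 2 ^ n) \<in> borel_measurable M"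
  by (rule random_variable) simp

text \<open>
  The process observed at the next grid time is jointly measurable because the grid is countable, and by
  right-continuity it converges to the process itself.
\<close>

lemma X_joint_measurable [measurable]:
  "(\<lambda>(s, \<omega>). X (max 0 s) \<omega>) \<in> borel_measurable (borel \<Otimes>\<^sub>M M)"
proof (rule borel_measurable_LIMSEQ_real)
  fix p :: "real \<times> 'w" assume "p \<in> space (borel \<Otimes>\<^sub>M M)"
  show "(\<lambda>n. case p of (s, \<omega>) \<Rightarrow> X (real (grid_above n (max 0 s)) / 2 ^ n) \<omega>) \<longlonglongrightarrow> (case p of (s, \<omega>) \<Rightarrow> X (max 0 s) \<omega>)"
  proof (cases p)
    case (Pair s \<omega>)
    have "0 \<le> max 0 s" by simp
    then show ?thesis unfolding Pair split using grid_above[of "max 0 s"]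
      by (intro right_continuous_seq[OF paths] grid_above_tendsto) (auto intro: less_imp_le)
  qed
next
  fix n
  have 1: "(\<lambda>p. grid_above n (max 0 (fst p))) \<in> measurable (borel \<Otimes>\<^sub>M M) (count_space UNIV)"
    unfolding grid_above_def by measurable
  have 2: "(\<lambda>p. X (real k / 2 ^ n) (snd p)) \<in> borel_measurable (borel \<Otimes>\<^sub>M M)" for k
    by measurable
  show "(\<lambda>(s, \<omega>). X (real (grid_above n (max 0 s)) / 2 ^ n) \<omega>) \<in> borel_measurable (borel \<Otimes>\<^sub>M M)"
    using measurable_compose_countable[OF 2 1] by (simp add: split_beta')
qed

abbreviation b :: real where "b \<equiv> m powr (1 / \<alpha>)"

abbreviation a :: real where "a \<equiv> \<alpha> / 2"

lemma a: "0 < a" "a < 1" and b: "0 < b"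
  using alpha m_pos by auto

lemma b_powr: "b\<^sup>2 = m powr (2 / \<alpha>)" "(b\<^sup>2) powr a = m"
proof -
  show 1: "b\<^sup>2 = m powr (2 / \<alpha>)" using m_pos by (simp add: powr_power)
  show "(b\<^sup>2) powr a = m" unfolding 1 using m_pos alpha by (simp add: powr_powr)
qed

text \<open>
  Killing at rate \<open>m\<close> cancels the factor \<open>exp (m t)\<close> of the characteristic function.  What is left
  integrates to \<open>(b\<^sup>2 / (b\<^sup>2 + z\<^sup>2)) powr a\<close>, the squared modulus of a Gamma characteristic function.
\<close>

lemma law_at_exponential_time:
  "distr (density lborel (exponential_density m) \<Otimes>\<^sub>M M) borel (\<lambda>(s, \<omega>). X (max 0 s) \<omega>) = gamma_difference a b"
proof (rule Levy_uniqueness)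
  let ?E = "density lborel (exponential_density m)"
  let ?D = "distr (?E \<Otimes>\<^sub>M M) borel (\<lambda>(s, \<omega>). X (max 0 s) \<omega>)"
  interpret E: prob_space ?E by (rule prob_space_exponential_density[OF m_pos])
  interpret P: pair_prob_space ?E M ..
  show "real_distribution (gamma_difference a b)" using a b by (intro real_distribution_gamma_difference)
  have meas [measurable]: "(\<lambda>(s, \<omega>). X (max 0 s) \<omega>) \<in> borel_measurable (?E \<Otimes>\<^sub>M M)"
    by measurable
  interpret D: prob_space ?D by (rule P.prob_space_distr) measurable
  show "real_distribution ?D" by standard auto
  show "char ?D = char (gamma_difference a b)"
  proof
    fix z
    define \<phi> where "\<phi> = (b\<^sup>2 + z\<^sup>2) powr a"
    have bz: "0 < b\<^sup>2 + z\<^sup>2" using b by (intro add_pos_nonneg) auto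
    then have \<phi>: "0 < \<phi>" unfolding \<phi>_def powr_gt_zero by (metis less_irrefl)
    have int: "integrable (?E \<Otimes>\<^sub>M M) (\<lambda>(s, \<omega>). iexp (z * X (max 0 s) \<omega>))"
      by (rule P.integrable_const_bound[of _ 1]) (auto simp: split_beta' simp flip: of_real_mult)
    have "char ?D z = (\<integral>p. (\<lambda>(s, \<omega>). iexp (z * X (max 0 s) \<omega>)) p \<partial>(?E \<Otimes>\<^sub>M M))"
      unfolding char_def by (subst integral_distr) (auto simp: split_beta')
    also have "\<dots> = (\<integral>s. (\<integral>\<omega>. iexp (z * X (max 0 s) \<omega>) \<partial>M) \<partial>?E)"
      using P.integral_fst'[OF int] by simp
    also have "\<dots> = (\<integral>s. of_real (exp (m * max 0 s) * exp (- max 0 s * \<phi>)) \<partial>?E)"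
    proof (intro Bochner_Integration.integral_cong refl)
      fix s :: real
      have "(\<integral>\<omega>. iexp (z * X (max 0 s) \<omega>) \<partial>M) = char (distr M borel (X (max 0 s))) z"
        unfolding char_def by (subst integral_distr) auto
      also have "\<dots> = of_real (exp (m * max 0 s) * exp (- max 0 s * \<phi>))"
        by (subst char_relativistic) (simp_all add: \<phi>_def b_powr add.commute)
      finally show "(\<integral>\<omega>. iexp (z * X (max 0 s) \<omega>) \<partial>M) = of_real (exp (m * max 0 s) * exp (- max 0 s * \<phi>))" .
    qed
    also have "\<dots> = of_real (\<integral>s. exp (m * max 0 s) * exp (- max 0 s * \<phi>) \<partial>?E)"
      by (rule integral_complex_of_real)
    also have "(\<integral>s. exp (m * max 0 s) * exp (- max 0 s * \<phi>) \<partial>?E) =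
        (\<integral>s. exponential_density m s * (exp (m * max 0 s) * exp (- max 0 s * \<phi>)) \<partial>lborel)"
      using m_pos by (subst integral_density) (auto simp: exponential_density_def)
    also have "\<dots> = (\<integral>s. (m / \<phi>) * exponential_density \<phi> s \<partial>lborel)"
    proof (intro Bochner_Integration.integral_cong refl)
      fix s :: real
      show "exponential_density m s * (exp (m * max 0 s) * exp (- max 0 s * \<phi>)) = m / \<phi> * exponential_density \<phi> s"
        using \<phi> by (auto simp: exponential_density_def exp_add[symmetric] algebra_simps)
    qed
    also have "\<dots> = m / \<phi>"
    proof -
      have "(\<integral>\<^sup>+s. ennreal (exponential_density \<phi> s) \<partial>lborel) = 1"
        using prob_space.emeasure_space_1[OF prob_space_exponential_density[OF \<phi>]] by (simp add: emeasure_density)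
      then have "integral\<^sup>L lborel (exponential_density \<phi>) = 1"
        using \<phi> by (subst integral_eq_nn_integral) (auto simp: exponential_density_def)
      then show ?thesis by simp
    qed
    also have "m / \<phi> = (b\<^sup>2 / (b\<^sup>2 + z\<^sup>2)) powr a"
      using bz b_powr(2) by (simp add: powr_divide \<phi>_def)
    finally show "char ?D z = char (gamma_difference a b) z"
      using char_gamma_difference[OF a(1) b] by simp
  qed
qed

lemma nn_integral_exponential_time:
  assumes [measurable]: "f \<in> borel_measurable borel"
  shows "(\<integral>\<^sup>+v. f v \<partial>gamma_difference a b) =
    (\<integral>\<^sup>+s. ennreal (exponential_density m s) * (\<integral>\<^sup>+\<omega>. f (X (max 0 s) \<omega>) \<partial>M) \<partial>lborel)"
proof -
  have [measurable]: "(\<lambda>(s, \<omega>). X (max 0 s) \<omega>) \<in> borel_measurable (density lborel (exponential_density m) \<Otimes>\<^sub>M M)"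
    by measurable
  have "(\<integral>\<^sup>+v. f v \<partial>gamma_difference a b) =
      (\<integral>\<^sup>+p. f ((\<lambda>(s, \<omega>). X (max 0 s) \<omega>) p) \<partial>(density lborel (exponential_density m) \<Otimes>\<^sub>M M))"
    unfolding law_at_exponential_time[symmetric] by (rule nn_integral_distr) measurable
  also have "\<dots> = (\<integral>\<^sup>+s. (\<integral>\<^sup>+\<omega>. f (X (max 0 s) \<omega>) \<partial>M) \<partial>density lborel (exponential_density m))"
    by (subst nn_integral_fst[symmetric]) (auto simp: split_beta')
  also have "\<dots> = (\<integral>\<^sup>+s. ennreal (exponential_density m s) * (\<integral>\<^sup>+\<omega>. f (X (max 0 s) \<omega>) \<partial>M) \<partial>lborel)"
    by (rule nn_integral_density) measurable
  finally show ?thesis .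
qed

end

section \<open>The Markov property at grid times\<close>

context regular_relativistic_process
begin

text \<open>
  The positions up to time \<open>k * \<delta>\<close> are partial sums of increments, and the next increment is independent of
  these and has the law of \<open>X s\<close>.
\<close>

lemma markov_fixed_time:
  assumes \<delta>: "0 \<le> \<delta>" and s: "0 \<le> s"
    and B: "B \<in> sets (PiM {..k} (\<lambda>_. borel))" and f [measurable]: "f \<in> borel_measurable borel"
  shows "(\<integral>\<^sup>+\<omega>. indicator B (\<lambda>i\<in>{..k}. X (real i * \<delta>) \<omega>) * f (X (real k * \<delta> + s) \<omega>) \<partial>M) =
    (\<integral>\<^sup>+\<omega>. indicator B (\<lambda>i\<in>{..k}. X (real i * \<delta>) \<omega>) * (\<integral>\<^sup>+\<omega>'. f (X (real k * \<delta>) \<omega> + X s \<omega>') \<partial>M) \<partial>M)"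
proof -
  \<comment> \<open>The grid times up to \<open>k\<close>, followed by the later time \<open>real k * \<delta> + s\<close>.\<close>
  define t where "t i = (if i \<le> k then real i * \<delta> else real k * \<delta> + s)" for i
  define D where "D i \<omega> = X (t (Suc i)) \<omega> - X (t i) \<omega>" for i \<omega>
  have "indep_vars (\<lambda>_. borel) D {..<Suc k}"
    unfolding D_def
  proof (rule independent_increments)
    show "\<forall>i<Suc k. t i \<le> t (Suc i)"
    proof (intro allI impI)
      fix i assume "i < Suc k"
      show "t i \<le> t (Suc i)"
      proof (cases "i < k")
        case True
        then show ?thesis using \<delta> by (simp add: t_def mult_right_mono)
      next
        case False
        with \<open>i < Suc k\<close> have "i = k" by simp
        then show ?thesis using s by (simp add: t_def)
      qed
    qed
  qed (use \<delta> in \<open>simp add: t_def\<close>)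
  then have ind: "indep_var (PiM {..<k} (\<lambda>_. borel)) (\<lambda>\<omega>. \<lambda>i\<in>{..<k}. D i \<omega>) (PiM {k} (\<lambda>_. borel)) (\<lambda>\<omega>. \<lambda>i\<in>{k}. D i \<omega>)"
    by (rule indep_var_restrict) auto
  define V where "V \<omega> = (\<lambda>i\<in>{..<k}. D i \<omega>)" for \<omega>
  define R where "R \<omega> = (\<lambda>i\<in>{k}. D i \<omega>)" for \<omega>
  have iv: "indep_var (PiM {..<k} (\<lambda>_. borel)) V (PiM {k} (\<lambda>_. borel)) R"
    using ind by (simp add: V_def[abs_def] R_def[abs_def])
  note V [measurable] = indep_var_rv1[OF iv] and R [measurable] = indep_var_rv2[OF iv]
  have joint: "distr M (PiM {..<k} (\<lambda>_. borel)) V \<Otimes>\<^sub>M distr M (PiM {k} (\<lambda>_. borel)) R =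
      distr M (PiM {..<k} (\<lambda>_. borel) \<Otimes>\<^sub>M PiM {k} (\<lambda>_. borel)) (\<lambda>\<omega>. (V \<omega>, R \<omega>))"
    using iv indep_var_distribution_eq by blast
  have R_k [measurable]: "(\<lambda>w. w k) \<in> borel_measurable (PiM {k} (\<lambda>_. borel))"
    by (rule measurable_component_singleton) simp
  have [measurable]: "(\<lambda>\<omega>. R \<omega> k) \<in> borel_measurable M"
    by (rule measurable_compose[OF R R_k])
  define S where "S v i = (\<Sum>j<i. v j)" for v :: "nat \<Rightarrow> real" and i
  have S: "X (real i * \<delta>) \<omega> = S (V \<omega>) i" if "i \<le> k" for i \<omega>
    using that
  proof (induction i)
    case (Suc i)
    then show ?case by (simp add: S_def V_def D_def t_def)
  qed (simp add: S_def start)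
  have end_point: "X (real k * \<delta> + s) \<omega> = S (V \<omega>) k + R \<omega> k" for \<omega>
    using S[of k \<omega>] by (simp add: R_def D_def t_def)
  have past: "(\<lambda>i\<in>{..k}. X (real i * \<delta>) \<omega>) = (\<lambda>i\<in>{..k}. S (V \<omega>) i)" for \<omega>
    using S by (intro restrict_ext) auto
  have S_meas [measurable]: "(\<lambda>v. S v i) \<in> borel_measurable (PiM {..<k} (\<lambda>_. borel))" if "i \<le> k" for i
    unfolding S_def using that by (intro borel_measurable_sum measurable_component_singleton) auto
  have Sk [measurable]: "(\<lambda>v. S v k) \<in> borel_measurable (PiM {..<k} (\<lambda>_. borel))" by simp
  have P_meas: "(\<lambda>v. \<lambda>i\<in>{..k}. S v i) \<in> measurable (PiM {..<k} (\<lambda>_. borel)) (PiM {..k} (\<lambda>_. borel))"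
    by (intro measurable_restrict S_meas) auto
  have B_meas [measurable]: "(\<lambda>v. indicator B (\<lambda>i\<in>{..k}. S v i) :: ennreal) \<in> borel_measurable (PiM {..<k} (\<lambda>_. borel))"
    using measurable_compose[OF P_meas borel_measurable_indicator[OF B]] .
  have Xs [measurable]: "X s \<in> borel_measurable M" by (rule random_variable[OF s])
  have law: "distr M borel (\<lambda>\<omega>. R \<omega> k) = distr M borel (X s)"
  proof -
    have "distr M borel (\<lambda>\<omega>. R \<omega> k) = distr M borel (\<lambda>\<omega>. X (real k * \<delta> + s) \<omega> - X (real k * \<delta>) \<omega>)"
      by (simp add: R_def D_def[abs_def] t_def)
    also have "\<dots> = distr M borel (X s)"
      using stationary_increments[of "real k * \<delta>" s] \<delta> s by (simp add: start)
    finally show ?thesis .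
  qed
  interpret R: prob_space "distr M (PiM {k} (\<lambda>_. borel)) R" by (rule prob_space_distr) measurable
  let ?G = "\<lambda>(v, r). indicator B (\<lambda>i\<in>{..k}. S v i) * f (S v k + r k)"
  have "(\<integral>\<^sup>+\<omega>. indicator B (\<lambda>i\<in>{..k}. X (real i * \<delta>) \<omega>) * f (X (real k * \<delta> + s) \<omega>) \<partial>M) =
      (\<integral>\<^sup>+\<omega>. ?G (V \<omega>, R \<omega>) \<partial>M)"
    by (simp add: past end_point)
  also have "\<dots> = (\<integral>\<^sup>+p. ?G p \<partial>(distr M (PiM {..<k} (\<lambda>_. borel)) V \<Otimes>\<^sub>M distr M (PiM {k} (\<lambda>_. borel)) R))"
    unfolding joint by (rule nn_integral_distr[symmetric]) measurable
  also have "\<dots> = (\<integral>\<^sup>+v. \<integral>\<^sup>+r. ?G (v, r) \<partial>distr M (PiM {k} (\<lambda>_. borel)) R \<partial>distr M (PiM {..<k} (\<lambda>_. borel)) V)"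
    by (rule R.nn_integral_fst[symmetric]) measurable
  also have "\<dots> = (\<integral>\<^sup>+\<omega>. \<integral>\<^sup>+r. ?G (V \<omega>, r) \<partial>distr M (PiM {k} (\<lambda>_. borel)) R \<partial>M)"
    by (rule nn_integral_distr) measurable
  also have "\<dots> = (\<integral>\<^sup>+\<omega>. indicator B (\<lambda>i\<in>{..k}. X (real i * \<delta>) \<omega>) * (\<integral>\<^sup>+\<omega>'. f (X (real k * \<delta>) \<omega> + X s \<omega>') \<partial>M) \<partial>M)"
  proof (intro nn_integral_cong)
    fix \<omega>
    have "(\<integral>\<^sup>+r. ?G (V \<omega>, r) \<partial>distr M (PiM {k} (\<lambda>_. borel)) R) =
        indicator B (\<lambda>i\<in>{..k}. S (V \<omega>) i) * (\<integral>\<^sup>+\<omega>'. f (S (V \<omega>) k + R \<omega>' k) \<partial>M)"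
      by (simp add: nn_integral_cmult nn_integral_distr)
    also have "(\<integral>\<^sup>+\<omega>'. f (S (V \<omega>) k + R \<omega>' k) \<partial>M) = (\<integral>\<^sup>+r. f (S (V \<omega>) k + r) \<partial>distr M borel (\<lambda>\<omega>. R \<omega> k))"
      using nn_integral_distr[of "\<lambda>\<omega>. R \<omega> k" M borel "\<lambda>r. f (S (V \<omega>) k + r)"] by simp
    also have "\<dots> = (\<integral>\<^sup>+\<omega>'. f (S (V \<omega>) k + X s \<omega>') \<partial>M)"
      unfolding law using nn_integral_distr[OF Xs, of "\<lambda>r. f (S (V \<omega>) k + r)"] by simp
    finally show "(\<integral>\<^sup>+r. ?G (V \<omega>, r) \<partial>distr M (PiM {k} (\<lambda>_. borel)) R) =
        indicator B (\<lambda>i\<in>{..k}. X (real i * \<delta>) \<omega>) * (\<integral>\<^sup>+\<omega>'. f (X (real k * \<delta>) \<omega> + X s \<omega>') \<partial>M)"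
      unfolding past S[OF order_refl] .
  qed
  finally show ?thesis .
qed

lemma X_joint_measurable_swap [measurable]:
  "(\<lambda>(\<omega>, s). X (max 0 s) \<omega>) \<in> borel_measurable (M \<Otimes>\<^sub>M borel)"
  using measurable_compose[OF measurable_pair_swap' X_joint_measurable] by (simp add: split_beta')

lemma X_shift_measurable [measurable]:
  assumes "0 \<le> T"
  shows "(\<lambda>(\<omega>, s). X (T + max 0 s) \<omega>) \<in> borel_measurable (M \<Otimes>\<^sub>M borel)"
proof -
  have "(\<lambda>p. (fst p, T + max 0 (snd p))) \<in> measurable (M \<Otimes>\<^sub>M borel) (M \<Otimes>\<^sub>M borel)" by measurable
  from measurable_compose[OF this X_joint_measurable_swap] show ?thesis
    using assms by (simp add: split_beta' max_def)
qed

lemma markov_exponential_time: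
  assumes \<delta>: "0 \<le> \<delta>"
    and B: "B \<in> sets (PiM {..k} (\<lambda>_. borel))" and f [measurable]: "f \<in> borel_measurable borel"
  shows "(\<integral>\<^sup>+\<omega>. indicator B (\<lambda>i\<in>{..k}. X (real i * \<delta>) \<omega>) *
        (\<integral>\<^sup>+s. ennreal (exponential_density m s) * f (X (real k * \<delta> + max 0 s) \<omega>) \<partial>lborel) \<partial>M) =
    (\<integral>\<^sup>+\<omega>. indicator B (\<lambda>i\<in>{..k}. X (real i * \<delta>) \<omega>) *
        (\<integral>\<^sup>+v. f (X (real k * \<delta>) \<omega> + v) \<partial>gamma_difference a b) \<partial>M)"
proof -
  interpret pair_sigma_finite M lborel ..
  let ?I = "\<lambda>\<omega>. indicator B (\<lambda>i\<in>{..k}. X (real i * \<delta>) \<omega>) :: ennreal"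
  have P: "(\<lambda>\<omega>. \<lambda>i\<in>{..k}. X (real i * \<delta>) \<omega>) \<in> measurable M (PiM {..k} (\<lambda>_. borel))"
    using \<delta> by (intro measurable_restrict random_variable) auto
  have [measurable]: "?I \<in> borel_measurable M"
    using measurable_compose[OF P borel_measurable_indicator[OF B]] .
  have T: "0 \<le> real k * \<delta>" using \<delta> by simp
  note X_shift_measurable[OF T, measurable]
  have [measurable]: "X (real k * \<delta>) \<in> borel_measurable M" by (rule random_variable[OF T])
  have [measurable]: "(\<lambda>\<omega>. X (real k * \<delta> + max 0 s) \<omega>) \<in> borel_measurable M" for s
    using T by (intro random_variable) auto
  have "(\<integral>\<^sup>+\<omega>. ?I \<omega> * (\<integral>\<^sup>+s. ennreal (exponential_density m s) * f (X (real k * \<delta> + max 0 s) \<omega>) \<partial>lborel) \<partial>M) =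
     (\<integral>\<^sup>+\<omega>. \<integral>\<^sup>+s. ?I \<omega> * (ennreal (exponential_density m s) * f (X (real k * \<delta> + max 0 s) \<omega>)) \<partial>lborel \<partial>M)"
    by (intro nn_integral_cong nn_integral_cmult[symmetric]) measurable
  also have "\<dots> = (\<integral>\<^sup>+s. \<integral>\<^sup>+\<omega>. ?I \<omega> * (ennreal (exponential_density m s) * f (X (real k * \<delta> + max 0 s) \<omega>)) \<partial>M \<partial>lborel)"
    by (rule Fubini'[symmetric]) measurable
  also have "\<dots> = (\<integral>\<^sup>+s. \<integral>\<^sup>+\<omega>. ?I \<omega> * (ennreal (exponential_density m s) * (\<integral>\<^sup>+\<omega>'. f (X (real k * \<delta>) \<omega> + X (max 0 s) \<omega>') \<partial>M)) \<partial>M \<partial>lborel)"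
  proof (rule nn_integral_cong)
    fix s :: real
    have inner [measurable]: "(\<lambda>\<omega>. \<integral>\<^sup>+\<omega>'. f (X (real k * \<delta>) \<omega> + X (max 0 s) \<omega>') \<partial>M) \<in> borel_measurable M"
      by measurable
    have "(\<integral>\<^sup>+\<omega>. ?I \<omega> * (ennreal (exponential_density m s) * f (X (real k * \<delta> + max 0 s) \<omega>)) \<partial>M) =
        ennreal (exponential_density m s) * (\<integral>\<^sup>+\<omega>. ?I \<omega> * f (X (real k * \<delta> + max 0 s) \<omega>) \<partial>M)"
      unfolding mult.left_commute[of "?I _"] by (rule nn_integral_cmult) measurable
    also have "\<dots> = ennreal (exponential_density m s) * (\<integral>\<^sup>+\<omega>. ?I \<omega> * (\<integral>\<^sup>+\<omega>'. f (X (real k * \<delta>) \<omega> + X (max 0 s) \<omega>') \<partial>M) \<partial>M)"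
      by (subst markov_fixed_time[OF \<delta> _ B f]) auto
    also have "\<dots> = (\<integral>\<^sup>+\<omega>. ?I \<omega> * (ennreal (exponential_density m s) * (\<integral>\<^sup>+\<omega>'. f (X (real k * \<delta>) \<omega> + X (max 0 s) \<omega>') \<partial>M)) \<partial>M)"
      unfolding mult.left_commute[of "?I _"] by (rule nn_integral_cmult[symmetric]) (use inner in measurable)
    finally show "(\<integral>\<^sup>+\<omega>. ?I \<omega> * (ennreal (exponential_density m s) * f (X (real k * \<delta> + max 0 s) \<omega>)) \<partial>M) =
      (\<integral>\<^sup>+\<omega>. ?I \<omega> * (ennreal (exponential_density m s) * (\<integral>\<^sup>+\<omega>'. f (X (real k * \<delta>) \<omega> + X (max 0 s) \<omega>') \<partial>M)) \<partial>M)" .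
  qed
  also have "\<dots> = (\<integral>\<^sup>+\<omega>. \<integral>\<^sup>+s. ?I \<omega> * (ennreal (exponential_density m s) * (\<integral>\<^sup>+\<omega>'. f (X (real k * \<delta>) \<omega> + X (max 0 s) \<omega>') \<partial>M)) \<partial>lborel \<partial>M)"
  proof (rule Fubini')
    have "(\<lambda>q. (snd (fst q), snd q)) \<in> measurable ((M \<Otimes>\<^sub>M lborel) \<Otimes>\<^sub>M M) (borel \<Otimes>\<^sub>M M)" by measurable
    from measurable_compose[OF this X_joint_measurable]
    have [measurable]: "(\<lambda>q. X (max 0 (snd (fst q))) (snd q)) \<in> borel_measurable ((M \<Otimes>\<^sub>M lborel) \<Otimes>\<^sub>M M)"
      by simp
    show "(\<lambda>(\<omega>, s). ?I \<omega> * (ennreal (exponential_density m s) * (\<integral>\<^sup>+\<omega>'. f (X (real k * \<delta>) \<omega> + X (max 0 s) \<omega>') \<partial>M))) \<in> borel_measurable (M \<Otimes>\<^sub>M lborel)"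
      by (simp add: split_beta', measurable) 
  qed
  also have "\<dots> = (\<integral>\<^sup>+\<omega>. ?I \<omega> * (\<integral>\<^sup>+v. f (X (real k * \<delta>) \<omega> + v) \<partial>gamma_difference a b) \<partial>M)"
  proof (intro nn_integral_cong)
    fix \<omega>
    have [measurable]: "(\<lambda>s. \<integral>\<^sup>+\<omega>'. f (X (real k * \<delta>) \<omega> + X (max 0 s) \<omega>') \<partial>M) \<in> borel_measurable borel"
    proof -
      have [measurable]: "(\<lambda>p. X (max 0 (fst p)) (snd p)) \<in> borel_measurable (borel \<Otimes>\<^sub>M M)"
        using X_joint_measurable by (simp add: split_beta')
      show ?thesis by measurable
    qed
    show "(\<integral>\<^sup>+s. ?I \<omega> * (ennreal (exponential_density m s) * (\<integral>\<^sup>+\<omega>'. f (X (real k * \<delta>) \<omega> + X (max 0 s) \<omega>') \<partial>M)) \<partial>lborel) =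
        ?I \<omega> * (\<integral>\<^sup>+v. f (X (real k * \<delta>) \<omega> + v) \<partial>gamma_difference a b)"
      by (subst nn_integral_exponential_time[of "\<lambda>v. f (X (real k * \<delta>) \<omega> + v)"]) (auto intro!: nn_integral_cmult)
  qed
  finally show ?thesis .
qed

lemma exponential_memoryless:
  assumes T: "0 \<le> T" and F [measurable]: "F \<in> borel_measurable borel"
  shows "(\<integral>\<^sup>+s. ennreal (exponential_density m s) * F (max 0 s) * indicator {T..} s \<partial>lborel) =
     ennreal (exp (- m * T)) * (\<integral>\<^sup>+s. ennreal (exponential_density m s) * F (T + max 0 s) \<partial>lborel)"
proof -
  have "(\<integral>\<^sup>+s. ennreal (exponential_density m s) * F (max 0 s) * indicator {T..} s \<partial>lborel) =
      (\<integral>\<^sup>+s. ennreal (exponential_density m (T + s)) * F (max 0 (T + s)) * indicator {T..} (T + s) \<partial>lborel)"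
    by (subst nn_integral_real_affine[where c = 1 and t = T]) auto
  also have "\<dots> = (\<integral>\<^sup>+s. ennreal (exp (- m * T)) * (ennreal (exponential_density m s) * F (T + max 0 s)) \<partial>lborel)"
  proof (intro nn_integral_cong)
    fix s :: real
    show "ennreal (exponential_density m (T + s)) * F (max 0 (T + s)) * indicator {T..} (T + s) =
        ennreal (exp (- m * T)) * (ennreal (exponential_density m s) * F (T + max 0 s))"
    proof (cases "0 \<le> s")
      case True
      then have "exponential_density m (T + s) = exp (- m * T) * exponential_density m s"
        using T by (simp add: exponential_density_def exp_add[symmetric] algebra_simps)
      then show ?thesis using True T m_pos
        by (simp add: ennreal_mult' mult_ac max_def exponential_density_def)
    qed (simp add: exponential_density_def)
  qed
  also have "\<dots> = ennreal (exp (- m * T)) * (\<integral>\<^sup>+s. ennreal (exponential_density m s) * F (T + max 0 s) \<partial>lborel)"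
    by (rule nn_integral_cmult) measurable
  finally show ?thesis .
qed

end

section \<open>Balayage at the first negative time\<close>

context regular_relativistic_process
begin

abbreviation path :: "real \<Rightarrow> 'w \<Rightarrow> real \<Rightarrow> real" where
  "path x \<omega> t \<equiv> x + X t \<omega>"

lemma path_right_continuous: "right_continuous (path x \<omega>)"
  using paths[of \<omega>] by (auto simp: right_continuous_def intro!: continuous_intros)

lemma grid_negative_measurable [measurable]: "Measurable.pred M (\<lambda>\<omega>. grid_negative n (path x \<omega>))"
  unfolding grid_negative_def by measurable

lemma grid_first_at_measurable [measurable]: "Measurable.pred M (\<lambda>\<omega>. grid_first_at n k (path x \<omega>))"
  unfolding grid_first_at_def by measurable

lemma grid_first_index_measurable [measurable]:
  "(\<lambda>\<omega>. grid_first_index n (path x \<omega>)) \<in> measurable M (count_space UNIV)"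
  unfolding grid_first_index_def by measurable

lemma X_grid_first_measurable [measurable]:
  "(\<lambda>\<omega>. X (grid_first_negative n (path x \<omega>)) \<omega>) \<in> borel_measurable M"
  by (rule measurable_compose_countable[OF X_grid_measurable grid_first_index_measurable])

lemma first_negative_measurable [measurable]: "(\<lambda>\<omega>. first_negative (path x \<omega>)) \<in> borel_measurable M"
  by (rule borel_measurable_LIMSEQ_real[OF grid_first_negative_tendsto[OF path_right_continuous]]) measurable

lemma X_first_negative_measurable [measurable]: "(\<lambda>\<omega>. X (first_negative (path x \<omega>)) \<omega>) \<in> borel_measurable M"
proof -
  have "(\<lambda>\<omega>. path x \<omega> (first_negative (path x \<omega>))) \<in> borel_measurable M"
    by (rule borel_measurable_LIMSEQ_real[OF value_grid_first_negative_tendsto[OF path_right_continuous]]) measurable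
  then have "(\<lambda>\<omega>. path x \<omega> (first_negative (path x \<omega>)) - x) \<in> borel_measurable M" by measurable
  then show ?thesis by simp
qed

lemma goes_negative_measurable [measurable]: "Measurable.pred M (\<lambda>\<omega>. goes_negative (path x \<omega>))"
proof -
  have "goes_negative (path x \<omega>) \<longleftrightarrow> (\<exists>n. grid_negative n (path x \<omega>))" for \<omega>
    using grid_negative_imp eventually_grid_negative[OF path_right_continuous, of x \<omega>]
      eventually_happens'[OF sequentially_bot] by blast
  then show ?thesis by simp
qed

text \<open>
  The weight \<open>exp (- m \<sigma>)\<close> at the first negative time \<open>\<sigma>\<close>, read as 0 if \<open>\<sigma>\<close> is infinite.
\<close>

definition discount :: "real \<Rightarrow> 'w \<Rightarrow> real" where
  "discount x \<omega> = (if goes_negative (path x \<omega>) then exp (- m * first_negative (path x \<omega>)) else 0)"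

lemma discount_measurable [measurable]: "discount x \<in> borel_measurable M"
  unfolding discount_def[abs_def] by measurable

lemma discount_bounds: "0 \<le> discount x \<omega>" "discount x \<omega> \<le> 1"
  using m_pos first_negative_nonneg[of "path x \<omega>"] by (auto simp: discount_def)

definition grid_discount :: "nat \<Rightarrow> real \<Rightarrow> 'w \<Rightarrow> real" where
  "grid_discount n x \<omega> = (if grid_negative n (path x \<omega>) then exp (- m * grid_first_negative n (path x \<omega>)) else 0)"

lemma grid_discount_measurable [measurable]: "grid_discount n x \<in> borel_measurable M"
  unfolding grid_discount_def[abs_def] by measurable

lemma grid_discount_bounds: "0 \<le> grid_discount n x \<omega>" "grid_discount n x \<omega> \<le> 1"
  using m_pos by (auto simp: grid_discount_def)

lemma grid_discount_tendsto: "(\<lambda>n. grid_discount n x \<omega>) \<longlonglongrightarrow> discount x \<omega>"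
proof (cases "goes_negative (path x \<omega>)")
  case True
  have "(\<lambda>n. exp (- m * grid_first_negative n (path x \<omega>))) \<longlonglongrightarrow> exp (- m * first_negative (path x \<omega>))"
    by (intro tendsto_intros grid_first_negative_tendsto path_right_continuous)
  moreover have "\<forall>\<^sub>F n in sequentially. exp (- m * grid_first_negative n (path x \<omega>)) = grid_discount n x \<omega>"
    using eventually_grid_negative[OF path_right_continuous True] by eventually_elim (simp add: grid_discount_def)
  ultimately show ?thesis using True by (simp add: discount_def Lim_transform_eventually)
next
  case False
  then have "\<not> grid_negative n (path x \<omega>)" for n using grid_negative_imp by blast
  with False show ?thesis by (simp add: discount_def grid_discount_def)
qed

text \<open>
  On the event that the first negative grid time is the \<open>k\<close>-th one, which is decided by the grid positions up to that time, the Markov property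
  restarts the process there; summing over \<open>k\<close> gives the claim.
\<close>

lemma balayage_grid:
  assumes h [measurable]: "h \<in> borel_measurable borel"
    and g: "\<And>u. u < 0 \<Longrightarrow> (\<integral>\<^sup>+v. h (u + v) \<partial>gamma_difference a b) = ennreal (g u)"
  shows "(\<integral>\<^sup>+\<omega>. \<integral>\<^sup>+s. ennreal (exponential_density m s) * h (path x \<omega> (max 0 s)) *
        indicator {s. grid_negative n (path x \<omega>) \<and> grid_first_negative n (path x \<omega>) \<le> s} s \<partial>lborel \<partial>M) =
     (\<integral>\<^sup>+\<omega>. ennreal (grid_discount n x \<omega>) * ennreal (g (path x \<omega> (grid_first_negative n (path x \<omega>)))) \<partial>M)"
proof -
  let ?e = "\<lambda>s. ennreal (exponential_density m s)"
  let ?T = "\<lambda>k::nat. real k / 2 ^ n"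
  let ?A = "\<lambda>k \<omega>. grid_first_at n k (path x \<omega>)"
  have T: "?T k = real k * (1 / 2 ^ n)" "0 \<le> ?T k" for k by auto
  have "(\<integral>\<^sup>+\<omega>. \<integral>\<^sup>+s. ?e s * h (path x \<omega> (max 0 s)) *
        indicator {s. grid_negative n (path x \<omega>) \<and> grid_first_negative n (path x \<omega>) \<le> s} s \<partial>lborel \<partial>M) =
     (\<integral>\<^sup>+\<omega>. (\<Sum>k. if ?A k \<omega> then \<integral>\<^sup>+s. ?e s * h (path x \<omega> (max 0 s)) * indicator {?T k..} s \<partial>lborel else 0) \<partial>M)"
    unfolding suminf_grid_first_at by (intro nn_integral_cong) (auto intro!: nn_integral_cong simp: indicator_def)
  also have "\<dots> = (\<integral>\<^sup>+\<omega>. (\<Sum>k. if ?A k \<omega> then ennreal (exp (- m * ?T k)) * (\<integral>\<^sup>+s. ?e s * h (path x \<omega> (?T k + max 0 s)) \<partial>lborel) else 0) \<partial>M)"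
  proof (intro nn_integral_cong suminf_cong if_cong refl)
    fix \<omega> k assume \<omega>: "\<omega> \<in> space M"
    have mx: "max 0 (?T k + max 0 s) = ?T k + max 0 s" for s by (simp add: max_def)
    have "(\<integral>\<^sup>+s. ?e s * h (path x \<omega> (max 0 s)) * indicator {?T k..} s \<partial>lborel) =
      (\<integral>\<^sup>+s. ?e s * h (path x \<omega> (max 0 (max 0 s))) * indicator {?T k..} s \<partial>lborel)" by simp
    also have "\<dots> = ennreal (exp (- m * ?T k)) * (\<integral>\<^sup>+s. ?e s * h (path x \<omega> (max 0 (?T k + max 0 s))) \<partial>lborel)"
      using measurable_Pair2[OF X_joint_measurable_swap \<omega>] by (intro exponential_memoryless T) simp
    finally show "(\<integral>\<^sup>+s. ?e s * h (path x \<omega> (max 0 s)) * indicator {?T k..} s \<partial>lborel) =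
       ennreal (exp (- m * ?T k)) * (\<integral>\<^sup>+s. ?e s * h (path x \<omega> (?T k + max 0 s)) \<partial>lborel)" by (simp only: mx)
  qed
  also have "\<dots> = (\<Sum>k. \<integral>\<^sup>+\<omega>. (if ?A k \<omega> then ennreal (exp (- m * ?T k)) * (\<integral>\<^sup>+s. ?e s * h (path x \<omega> (?T k + max 0 s)) \<partial>lborel) else 0) \<partial>M)"
  proof (rule nn_integral_suminf)
    fix k
    note X_shift_measurable[OF T(2)[of k], measurable]
    show "(\<lambda>\<omega>. if ?A k \<omega> then ennreal (exp (- m * ?T k)) * (\<integral>\<^sup>+s. ?e s * h (path x \<omega> (?T k + max 0 s)) \<partial>lborel) else 0) \<in> borel_measurable M"
      by measurable
  qed
  also have "\<dots> = (\<Sum>k. \<integral>\<^sup>+\<omega>. (if ?A k \<omega> then ennreal (exp (- m * ?T k)) * ennreal (g (path x \<omega> (?T k))) else 0) \<partial>M)"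
  proof (rule suminf_cong)
    fix k :: nat
    note X_shift_measurable[OF T(2)[of k], measurable]
    \<comment> \<open>The event in terms of the grid positions \<open>v\<close>, as the Markov property expects it.\<close>
    define B where "B = {v \<in> space (PiM {..k} (\<lambda>_. borel)). x + v k < 0 \<and> (\<forall>j<k. \<not> x + v j < (0::real))}"
    have less: "Measurable.pred (PiM {..k} (\<lambda>_. borel)) (\<lambda>v. x + v j < 0)" if "j \<le> k" for j
    proof -
      have [measurable]: "(\<lambda>v. v j) \<in> borel_measurable (PiM {..k} (\<lambda>_. borel :: real measure))"
        using that by (intro measurable_component_singleton) auto
      show ?thesis by measurable
    qed
    have "Measurable.pred (PiM {..k} (\<lambda>_. borel :: real measure)) (\<lambda>v. x + v k < 0 \<and> (\<forall>j\<in>{..<k}. \<not> x + v j < 0))"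
      by (intro pred_intros_logic pred_intros_finite less) (simp_all add: less_imp_le)
    then have B: "B \<in> sets (PiM {..k} (\<lambda>_. borel))"
      unfolding B_def pred_def by (simp add: Ball_def)
    have ind: "(indicator B (\<lambda>i\<in>{..k}. X (real i * (1 / 2 ^ n)) \<omega>) :: ennreal) = (if ?A k \<omega> then 1 else 0)" for \<omega>
      by (auto simp: B_def indicator_def grid_first_at_def space_PiM)
    have "(\<integral>\<^sup>+\<omega>. (if ?A k \<omega> then ennreal (exp (- m * ?T k)) * (\<integral>\<^sup>+s. ?e s * h (path x \<omega> (?T k + max 0 s)) \<partial>lborel) else 0) \<partial>M) =
        (\<integral>\<^sup>+\<omega>. ennreal (exp (- m * ?T k)) * (indicator B (\<lambda>i\<in>{..k}. X (real i * (1 / 2 ^ n)) \<omega>) *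
          (\<integral>\<^sup>+s. ?e s * h (x + X (real k * (1 / 2 ^ n) + max 0 s) \<omega>) \<partial>lborel)) \<partial>M)"
      unfolding ind T(1) by (intro nn_integral_cong) auto
    also have "\<dots> = ennreal (exp (- m * ?T k)) * (\<integral>\<^sup>+\<omega>. indicator B (\<lambda>i\<in>{..k}. X (real i * (1 / 2 ^ n)) \<omega>) *
          (\<integral>\<^sup>+s. ?e s * h (x + X (real k * (1 / 2 ^ n) + max 0 s) \<omega>) \<partial>lborel) \<partial>M)"
      unfolding ind unfolding T(1)[symmetric] by (rule nn_integral_cmult) measurable
    also have "(\<integral>\<^sup>+\<omega>. indicator B (\<lambda>i\<in>{..k}. X (real i * (1 / 2 ^ n)) \<omega>) *
          (\<integral>\<^sup>+s. ?e s * h (x + X (real k * (1 / 2 ^ n) + max 0 s) \<omega>) \<partial>lborel) \<partial>M) =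
       (\<integral>\<^sup>+\<omega>. indicator B (\<lambda>i\<in>{..k}. X (real i * (1 / 2 ^ n)) \<omega>) *
          (\<integral>\<^sup>+v. h (x + (X (real k * (1 / 2 ^ n)) \<omega> + v)) \<partial>gamma_difference a b) \<partial>M)"
      by (rule markov_exponential_time[OF _ B, of _ "\<lambda>u. h (x + u)"]) auto
    also have "\<dots> = (\<integral>\<^sup>+\<omega>. (if ?A k \<omega> then ennreal (g (path x \<omega> (?T k))) else 0) \<partial>M)"
    proof (rule nn_integral_cong)
      fix \<omega>
      show "indicator B (\<lambda>i\<in>{..k}. X (real i * (1 / 2 ^ n)) \<omega>) * (\<integral>\<^sup>+v. h (x + (X (real k * (1 / 2 ^ n)) \<omega> + v)) \<partial>gamma_difference a b) =
          (if ?A k \<omega> then ennreal (g (path x \<omega> (?T k))) else 0)"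
        unfolding ind unfolding T(1)[symmetric] using g[of "path x \<omega> (?T k)"] by (auto simp: grid_first_at_def add.assoc)
    qed
    also have "ennreal (exp (- m * ?T k)) * \<dots> = (\<integral>\<^sup>+\<omega>. ennreal (exp (- m * ?T k)) * (if ?A k \<omega> then ennreal (g (path x \<omega> (?T k))) else 0) \<partial>M)"
    proof (rule nn_integral_cmult[symmetric])
      have "(\<lambda>\<omega>. if ?A k \<omega> then ennreal (g (path x \<omega> (?T k))) else 0) =
          (\<lambda>\<omega>. if ?A k \<omega> then (\<integral>\<^sup>+v. h (path x \<omega> (?T k) + v) \<partial>gamma_difference a b) else 0)"
        using g by (auto simp: grid_first_at_def fun_eq_iff)
      moreover interpret K: real_distribution "gamma_difference a b" using a b by (intro real_distribution_gamma_difference)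
      have "(\<lambda>\<omega>. if ?A k \<omega> then (\<integral>\<^sup>+v. h (path x \<omega> (?T k) + v) \<partial>gamma_difference a b) else 0) \<in> borel_measurable M"
        by measurable
      ultimately show "(\<lambda>\<omega>. if ?A k \<omega> then ennreal (g (path x \<omega> (?T k))) else 0) \<in> borel_measurable M" by simp
    qed
    finally show "(\<integral>\<^sup>+\<omega>. (if ?A k \<omega> then ennreal (exp (- m * ?T k)) * (\<integral>\<^sup>+s. ?e s * h (path x \<omega> (?T k + max 0 s)) \<partial>lborel) else 0) \<partial>M) =
      (\<integral>\<^sup>+\<omega>. (if ?A k \<omega> then ennreal (exp (- m * ?T k)) * ennreal (g (path x \<omega> (?T k))) else 0) \<partial>M)"
      by (simp add: if_distrib[where f="\<lambda>z. _ * z"] cong: if_cong)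
  qed
  also have "\<dots> = (\<integral>\<^sup>+\<omega>. (\<Sum>k. if ?A k \<omega> then ennreal (exp (- m * ?T k)) * ennreal (g (path x \<omega> (?T k))) else 0) \<partial>M)"
  proof (rule nn_integral_suminf[symmetric])
    fix k
    interpret K: real_distribution "gamma_difference a b" using a b by (intro real_distribution_gamma_difference)
    have "(\<lambda>\<omega>. if ?A k \<omega> then ennreal (exp (- m * ?T k)) * ennreal (g (path x \<omega> (?T k))) else 0) =
        (\<lambda>\<omega>. if ?A k \<omega> then ennreal (exp (- m * ?T k)) * (\<integral>\<^sup>+v. h (path x \<omega> (?T k) + v) \<partial>gamma_difference a b) else 0)"
      using g by (auto simp: grid_first_at_def fun_eq_iff)
    also have "\<dots> \<in> borel_measurable M" by measurable
    finally show "(\<lambda>\<omega>. if ?A k \<omega> then ennreal (exp (- m * ?T k)) * ennreal (g (path x \<omega> (?T k))) else 0) \<in> borel_measurable M" .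
  qed
  also have "\<dots> = (\<integral>\<^sup>+\<omega>. ennreal (grid_discount n x \<omega>) * ennreal (g (path x \<omega> (grid_first_negative n (path x \<omega>)))) \<partial>M)"
    unfolding suminf_grid_first_at by (intro nn_integral_cong) (simp add: grid_discount_def)
  finally show ?thesis .
qed

end

context regular_relativistic_process
begin

text \<open>
  On refining the grid, the time set on the left increases to \<open>(\<sigma>, \<infinity>)\<close> or \<open>[\<sigma>, \<infinity>)\<close>, where \<open>\<sigma>\<close> is
  the first negative time.  This misses at most the single time \<open>\<sigma>\<close> among those at which \<open>h\<close> does not vanish.  On the right,
  dominated convergence applies, since the grid positions are negative and \<open>g\<close> is bounded there.
\<close>

lemma balayage:
  assumes h [measurable]: "h \<in> borel_measurable borel" and h_zero: "\<And>v. 0 \<le> v \<Longrightarrow> h v = 0"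
    and g: "\<And>u. u < 0 \<Longrightarrow> (\<integral>\<^sup>+v. h (u + v) \<partial>gamma_difference a b) = ennreal (g u)"
    and g_cont: "\<And>u. isCont g u" and g_bound: "\<And>u. u < 0 \<Longrightarrow> g u \<le> C"
  shows "(\<integral>\<^sup>+v. h (x + v) \<partial>gamma_difference a b) =
     (\<integral>\<^sup>+\<omega>. ennreal (discount x \<omega>) * ennreal (g (path x \<omega> (first_negative (path x \<omega>)))) \<partial>M)"
proof -
  interpret pair_sigma_finite M lborel ..
  let ?e = "\<lambda>s. ennreal (exponential_density m s)"
  define A where "A n \<omega> s \<longleftrightarrow> grid_negative n (path x \<omega>) \<and> grid_first_negative n (path x \<omega>) \<le> s" for n \<omega> s
  define F where "F n = (\<lambda>(\<omega>, s). ?e s * h (path x \<omega> (max 0 s)) * indicator {s. A n \<omega> s} s)" for n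
  define F' where "F' = (\<lambda>(\<omega>, s). ?e s * h (path x \<omega> (max 0 s)) * indicator {s. \<exists>n. A n \<omega> s} s)"
  have A_Suc: "A (Suc n) \<omega> s" if "A n \<omega> s" for n \<omega> s
    using that grid_refine[of n "path x \<omega>"] by (auto simp: A_def intro: order_trans)
  have A_mono: "A k \<omega> s" if "A n \<omega> s" "n \<le> k" for n k \<omega> s
    using that(2,1) by (induction rule: dec_induct) (auto intro: A_Suc)
  have F_meas: "F n \<in> borel_measurable (M \<Otimes>\<^sub>M lborel)" for n
  proof -
    have [measurable]: "(\<lambda>p. X (max 0 (snd p)) (fst p)) \<in> borel_measurable (M \<Otimes>\<^sub>M lborel)"
      using X_joint_measurable_swap by (simp add: split_beta' cong: measurable_cong_sets)
    show ?thesis unfolding F_def A_def split_beta' indicator_def mem_Collect_eq by measurable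
  qed
  have F_lim: "(\<lambda>n. F n p) \<longlonglongrightarrow> F' p" for p
  proof (cases "\<exists>n. A n (fst p) (snd p)")
    case True
    then obtain n where "A n (fst p) (snd p)" by blast
    then have "\<forall>\<^sub>F k in sequentially. F' p = F k p"
      using A_mono by (intro eventually_sequentiallyI[of n]) (auto simp: F_def F'_def split_beta' indicator_def)
    then show ?thesis by (rule Lim_transform_eventually[OF tendsto_const])
  qed (simp add: F_def F'_def split_beta' indicator_def)
  have F_inc: "incseq F"
    using A_Suc by (intro incseq_SucI) (auto simp: F_def le_fun_def indicator_def split_beta')
  have F'_meas: "F' \<in> borel_measurable (M \<Otimes>\<^sub>M lborel)"
  proof -
    have [measurable]: "(\<lambda>p. X (max 0 (snd p)) (fst p)) \<in> borel_measurable (M \<Otimes>\<^sub>M lborel)"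
      using X_joint_measurable_swap by (simp add: split_beta' cong: measurable_cong_sets)
    show ?thesis unfolding F'_def A_def split_beta' indicator_def mem_Collect_eq by measurable
  qed
  have grid: "(\<integral>\<^sup>+p. F n p \<partial>(M \<Otimes>\<^sub>M lborel)) =
      (\<integral>\<^sup>+\<omega>. ennreal (grid_discount n x \<omega>) * ennreal (g (path x \<omega> (grid_first_negative n (path x \<omega>)))) \<partial>M)" for n
    using balayage_grid[OF h g, of x n] lborel.nn_integral_fst[OF F_meas, of n] by (simp add: F_def A_def)
  have exact: "(\<integral>\<^sup>+v. h (x + v) \<partial>gamma_difference a b) = (\<integral>\<^sup>+p. F' p \<partial>(M \<Otimes>\<^sub>M lborel))"
  proof -
    have [measurable]: "(\<lambda>p. X (max 0 (snd p)) (fst p)) \<in> borel_measurable (M \<Otimes>\<^sub>M lborel)"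
      using X_joint_measurable_swap by (simp add: split_beta' cong: measurable_cong_sets)
    have "(\<integral>\<^sup>+v. h (x + v) \<partial>gamma_difference a b) = (\<integral>\<^sup>+s. ?e s * (\<integral>\<^sup>+\<omega>. h (path x \<omega> (max 0 s)) \<partial>M) \<partial>lborel)"
      by (rule nn_integral_exponential_time) measurable
    also have "\<dots> = (\<integral>\<^sup>+s. \<integral>\<^sup>+\<omega>. ?e s * h (path x \<omega> (max 0 s)) \<partial>M \<partial>lborel)"
      by (intro nn_integral_cong nn_integral_cmult[symmetric]) measurable
    also have "\<dots> = (\<integral>\<^sup>+\<omega>. \<integral>\<^sup>+s. ?e s * h (path x \<omega> (max 0 s)) \<partial>lborel \<partial>M)"
      by (rule Fubini') (simp add: split_beta', measurable)
    also have "\<dots> = (\<integral>\<^sup>+\<omega>. \<integral>\<^sup>+s. F' (\<omega>, s) \<partial>lborel \<partial>M)"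
    proof (rule nn_integral_cong, rule nn_integral_cong_AE)
      fix \<omega>
      show "AE s in lborel. ?e s * h (path x \<omega> (max 0 s)) = F' (\<omega>, s)"
        using AE_lborel_singleton[of "first_negative (path x \<omega>)"]
      proof eventually_elim
        fix s assume s: "s \<noteq> first_negative (path x \<omega>)"
        show "?e s * h (path x \<omega> (max 0 s)) = F' (\<omega>, s)"
        proof (cases "0 \<le> s \<and> path x \<omega> s < 0")
          case True
          then have "first_negative (path x \<omega>) < s"
            using first_negative_le[of s "path x \<omega>"] s by simp
          then have "\<exists>n. A n \<omega> s"
            using True unfolding A_def by (intro grid_first_negative_before[OF path_right_continuous, of s]) auto
          then show ?thesis by (simp add: F'_def)
        next
          case False
          then have "?e s * h (path x \<omega> (max 0 s)) = 0"
            using h_zero[of "path x \<omega> s"] by (auto simp: exponential_density_def max_def not_le not_less)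
          then show ?thesis by (simp only: F'_def split mult_zero_left)
        qed
      qed
    qed
    also have "\<dots> = (\<integral>\<^sup>+p. F' p \<partial>(M \<Otimes>\<^sub>M lborel))"
      by (rule lborel.nn_integral_fst[OF F'_meas])
    finally show ?thesis .
  qed
  have [measurable]: "g \<in> borel_measurable borel"
    using g_cont by (intro borel_measurable_continuous_onI continuous_at_imp_continuous_on) auto
  have lim1: "(\<lambda>n. \<integral>\<^sup>+\<omega>. ennreal (grid_discount n x \<omega>) * ennreal (g (path x \<omega> (grid_first_negative n (path x \<omega>)))) \<partial>M) \<longlonglongrightarrow>
      (\<integral>\<^sup>+\<omega>. ennreal (discount x \<omega>) * ennreal (g (path x \<omega> (first_negative (path x \<omega>)))) \<partial>M)"
  proof (rule nn_integral_dominated_convergence[where w = "\<lambda>_. ennreal C"])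
    show "AE \<omega> in M. ennreal (grid_discount n x \<omega>) * ennreal (g (path x \<omega> (grid_first_negative n (path x \<omega>)))) \<le> ennreal C" for n
    proof (rule AE_I2)
      fix \<omega>
      show "ennreal (grid_discount n x \<omega>) * ennreal (g (path x \<omega> (grid_first_negative n (path x \<omega>)))) \<le> ennreal C"
      proof (cases "grid_negative n (path x \<omega>)")
        case True
        then have "g (path x \<omega> (grid_first_negative n (path x \<omega>))) \<le> C"
          by (intro g_bound grid_first_negative_neg)
        moreover have "ennreal (grid_discount n x \<omega>) \<le> 1" using grid_discount_bounds[of n x \<omega>] by simp
        ultimately have "ennreal (grid_discount n x \<omega>) * ennreal (g (path x \<omega> (grid_first_negative n (path x \<omega>)))) \<le> 1 * ennreal C"
          by (intro mult_mono ennreal_leI) auto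
        then show ?thesis by simp
      qed (simp add: grid_discount_def)
    qed
    show "AE \<omega> in M. (\<lambda>n. ennreal (grid_discount n x \<omega>) * ennreal (g (path x \<omega> (grid_first_negative n (path x \<omega>))))) \<longlonglongrightarrow>
        ennreal (discount x \<omega>) * ennreal (g (path x \<omega> (first_negative (path x \<omega>))))"
    proof (rule AE_I2)
      fix \<omega>
      have "(\<lambda>n. g (path x \<omega> (grid_first_negative n (path x \<omega>)))) \<longlonglongrightarrow> g (path x \<omega> (first_negative (path x \<omega>)))"
        by (rule isCont_tendsto_compose[OF g_cont value_grid_first_negative_tendsto[OF path_right_continuous]])
      then show "(\<lambda>n. ennreal (grid_discount n x \<omega>) * ennreal (g (path x \<omega> (grid_first_negative n (path x \<omega>))))) \<longlonglongrightarrow>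
        ennreal (discount x \<omega>) * ennreal (g (path x \<omega> (first_negative (path x \<omega>))))"
        by (intro tendsto_mult_ennreal tendsto_ennrealI grid_discount_tendsto) auto
    qed
    show "(\<integral>\<^sup>+\<omega>. ennreal C \<partial>M) < \<infinity>" by (simp add: emeasure_space_1)
  qed measurable
  have lim2: "(\<lambda>n. \<integral>\<^sup>+p. F n p \<partial>(M \<Otimes>\<^sub>M lborel)) \<longlonglongrightarrow> (\<integral>\<^sup>+p. F' p \<partial>(M \<Otimes>\<^sub>M lborel))"
    by (rule nn_integral_LIMSEQ[OF F_inc F_meas F_lim])
  show ?thesis
    unfolding exact by (rule LIMSEQ_unique[OF lim2[unfolded grid] lim1])
qed

text \<open>
  Balayage for a Gamma density with shape \<open>1 - a\<close>, reflected and shifted so that it lives on \<open>(- \<infinity>, y)\<close>.  The constant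
  \<open>?K\<close> below is the factor of its expectation at the exponential time that does not depend on the starting point.
\<close>

lemma balayage_gamma_tail:
  assumes y: "y \<le> 0"
  shows "(\<integral>\<^sup>+\<omega>. ennreal (discount x \<omega>) * (ennreal (exp (b * path x \<omega> (first_negative (path x \<omega>)))) *
        emeasure (gamma_measure a (2 * b)) {path x \<omega> (first_negative (path x \<omega>)) - y<..}) \<partial>M) =
      ennreal (exp (b * x)) * emeasure (gamma_measure a (2 * b)) {x - y<..}"
proof -
  let ?G = "gamma_measure a (2 * b)" and ?K = "b * 2 powr (- a) * exp (- b * y)"
  interpret G: real_distribution ?G using a b by (intro real_distribution_gamma) auto
  have K: "0 < ?K" using b by simp
  define g where "g u = ?K * (exp (b * u) * (1 - cdf ?G (u - y)))" for u
  have tail: "measure ?G {r<..} = 1 - cdf ?G r" for r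
    using G.prob_compl[of "{..r}"] by (simp add: cdf_def Compl_eq_Diff_UNIV[symmetric] Compl_atMost)
  have g_tail: "ennreal (b * 2 powr (- a) * exp (b * (u - y))) * emeasure ?G {u - y<..} = ennreal (g u)" for u
  proof -
    have "b * 2 powr (- a) * exp (b * (u - y)) = ?K * exp (b * u)"
      by (simp add: exp_add[symmetric] algebra_simps)
    then show ?thesis using b
      unfolding G.emeasure_eq_measure tail g_def by (simp add: ennreal_mult'[symmetric] mult.assoc)
  qed
  have cont: "isCont (cdf ?G) r" for r
  proof -
    have "emeasure ?G {r} = (\<integral>\<^sup>+s. ennreal (gamma_density a (2 * b) s) * indicator {r} s \<partial>lborel)"
      unfolding gamma_measure_def by (rule emeasure_density) auto
    also have "\<dots> = (\<integral>\<^sup>+s. 0 \<partial>(lborel :: real measure))"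
    proof (rule nn_integral_cong_AE)
      show "AE s in lborel. ennreal (gamma_density a (2 * b) s) * indicator {r} s = 0"
        using AE_lborel_singleton[of r] by eventually_elim simp
    qed
    finally show ?thesis by (simp add: G.isCont_cdf measure_def)
  qed
  have "(\<integral>\<^sup>+v. ennreal (gamma_density (1 - a) b (y - (x + v))) \<partial>gamma_difference a b) =
      (\<integral>\<^sup>+\<omega>. ennreal (discount x \<omega>) * ennreal (g (path x \<omega> (first_negative (path x \<omega>)))) \<partial>M)"
  proof (rule balayage[where h = "\<lambda>v. ennreal (gamma_density (1 - a) b (y - v))" and C = ?K])
    show "ennreal (gamma_density (1 - a) b (y - v)) = 0" if "0 \<le> v" for v
      using that y by (simp add: gamma_density_def)
    show "(\<integral>\<^sup>+v. ennreal (gamma_density (1 - a) b (y - (u + v))) \<partial>gamma_difference a b) = ennreal (g u)" for u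
      unfolding nn_integral_gamma_difference_kernel[OF a b] by (rule g_tail)
    show "isCont g u" for u
      unfolding g_def by (intro continuous_intros isCont_o2[OF _ cont]) auto
    show "g u \<le> ?K" if "u < 0" for u
    proof -
      have "exp (b * u) * (1 - cdf ?G (u - y)) \<le> 1 * 1"
        using that b by (intro mult_mono) (auto simp: G.cdf_nonneg mult_le_0_iff G.cdf_bounded_prob)
      then show ?thesis unfolding g_def using K by (simp add: mult_left_le)
    qed
  qed measurable
  also have "(\<integral>\<^sup>+v. ennreal (gamma_density (1 - a) b (y - (x + v))) \<partial>gamma_difference a b) = ennreal (g x)"
    unfolding nn_integral_gamma_difference_kernel[OF a b] by (rule g_tail)
  finally have eq: "ennreal (g x) = (\<integral>\<^sup>+\<omega>. ennreal (discount x \<omega>) * ennreal (g (path x \<omega> (first_negative (path x \<omega>)))) \<partial>M)" .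
  have g_split: "ennreal (g u) = ennreal ?K * (ennreal (exp (b * u)) * emeasure ?G {u - y<..})" for u
    using K unfolding g_def G.emeasure_eq_measure tail by (simp add: ennreal_mult')
  have em_meas [measurable]: "(\<lambda>u. emeasure ?G {u - y<..}) \<in> borel_measurable borel"
    unfolding G.emeasure_eq_measure tail using cont
    by (intro measurable_compose[OF _ measurable_ennreal] borel_measurable_continuous_onI continuous_at_imp_continuous_on)
       (auto intro!: continuous_intros isCont_o2[OF _ cont])
  have "ennreal ?K * (ennreal (exp (b * x)) * emeasure ?G {x - y<..}) = (\<integral>\<^sup>+\<omega>. ennreal ?K * (ennreal (discount x \<omega>) * (ennreal (exp (b * path x \<omega> (first_negative (path x \<omega>)))) *
        emeasure ?G {path x \<omega> (first_negative (path x \<omega>)) - y<..})) \<partial>M)"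
    using eq unfolding g_split by (simp add: mult.left_commute)
  also have "\<dots> = ennreal ?K * (\<integral>\<^sup>+\<omega>. ennreal (discount x \<omega>) * (ennreal (exp (b * path x \<omega> (first_negative (path x \<omega>)))) *
        emeasure ?G {path x \<omega> (first_negative (path x \<omega>)) - y<..}) \<partial>M)"
    by (rule nn_integral_cmult) measurable
  finally show ?thesis
    using ennreal_mult_cancel_left[of "ennreal ?K"] K by auto
qed

end

section \<open>The law at the first negative time and the exit time\<close>

text \<open>
  Only the factor \<open>(- u) powr (- a)\<close> is singular, and the factor \<open>exp (b u)\<close> gives decay, so
  the densities for all starting points near \<open>x\<close> are dominated by one multiple of a reflected Gamma density.
\<close>

lemma overshoot_density_le_gamma_density:
  assumes a: "0 < a" "a < 1" and b: "0 < b" and x: "0 < x" and x': "x / 2 \<le> x'" "x' \<le> x"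
  shows "overshoot_density a b x' u \<le> 2 / x * x powr a * (Gamma (1 - a) / b powr (1 - a)) * gamma_density (1 - a) b (- u)"
proof (cases "u < 0")
  case True
  have "sin (pi * a) / pi \<le> 1"
  proof -
    have "sin (pi * a) \<le> pi" using sin_le_one[of "pi * a"] pi_ge_two by linarith
    then show ?thesis by simp
  qed
  moreover have "(x' / (- u)) powr a \<le> x powr a * (- u) powr (- a)"
  proof -
    have "(x' / (- u)) powr a = x' powr a / (- u) powr a"
      by (rule powr_divide)
    also have "\<dots> = x' powr a * (- u) powr (- a)" by (simp add: powr_minus_divide)
    also have "\<dots> \<le> x powr a * (- u) powr (- a)"
      using a x x' by (intro mult_right_mono powr_mono2) auto
    finally show ?thesis .
  qed
  moreover have "exp (- b * (x' - u)) / (x' - u) \<le> exp (- b * (- u)) / (x / 2)"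
  proof (rule frac_le)
    have "- b * (x' - u) \<le> - b * (- u)" using True b x x' by (intro mult_left_mono_neg) auto
    then show "exp (- b * (x' - u)) \<le> exp (- b * (- u))" by (simp only: exp_le_cancel_iff)
  qed (use True x x' in auto)
  moreover have "0 \<le> sin (pi * a)" using a by (intro sin_ge_zero) auto
  ultimately have "sin (pi * a) / pi * (x' / (- u)) powr a * (exp (- b * (x' - u)) / (x' - u)) \<le>
      1 * (x powr a * (- u) powr (- a)) * (exp (- b * (- u)) / (x / 2))"
    using True x x' by (intro mult_mono) auto
  also have "\<dots> = 2 / x * x powr a * (Gamma (1 - a) / b powr (1 - a)) * gamma_density (1 - a) b (- u)"
  proof -
    have "0 < Gamma (1 - a)" using a by (intro Gamma_real_pos) simp
    then show ?thesis using True b by (simp add: gamma_density_def)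
  qed
  finally show ?thesis using True by (simp add: overshoot_density_def)
next
  case False
  then show ?thesis by (simp add: overshoot_density_def gamma_density_def)
qed

lemma overshoot_mass_continuous:
  assumes a: "0 < a" "a < 1" and b: "0 < b" and x: "0 < x"
    and xs: "\<And>n. x / 2 \<le> xs n" "\<And>n. xs n \<le> x" "xs \<longlonglongrightarrow> x"
  shows "(\<lambda>n. \<integral>\<^sup>+u. ennreal (overshoot_density a b (xs n) u) \<partial>lborel) \<longlonglongrightarrow>
           (\<integral>\<^sup>+u. ennreal (overshoot_density a b x u) \<partial>lborel)"
proof (rule nn_integral_dominated_convergence)
  let ?C = "2 / x * x powr a * (Gamma (1 - a) / b powr (1 - a))"
  let ?w = "\<lambda>u. ennreal (?C * gamma_density (1 - a) b (- u))"
  have C: "0 \<le> ?C" using a b x Gamma_real_pos[of "1 - a"] by simp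
  show "AE u in lborel. ennreal (overshoot_density a b (xs n) u) \<le> ?w u" for n
    using overshoot_density_le_gamma_density[OF a b x xs(1,2)] by (intro AE_I2 ennreal_leI) auto
  have "(\<integral>\<^sup>+u. ?w u \<partial>lborel) = ennreal ?C * (\<integral>\<^sup>+u. ennreal (gamma_density (1 - a) b (- u)) \<partial>lborel)"
    unfolding ennreal_mult'[OF C] by (rule nn_integral_cmult) measurable
  also have "(\<integral>\<^sup>+u. ennreal (gamma_density (1 - a) b (- u)) \<partial>lborel) = (\<integral>\<^sup>+s. ennreal (gamma_density (1 - a) b s) \<partial>lborel)"
    by (subst (2) nn_integral_real_affine[where c = "-1" and t = 0]) auto
  also have "\<dots> = 1" using a b by (intro nn_integral_gamma_density) auto
  finally show "(\<integral>\<^sup>+u. ?w u \<partial>lborel) < \<infinity>" by simp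
  show "AE u in lborel. (\<lambda>n. ennreal (overshoot_density a b (xs n) u)) \<longlonglongrightarrow> ennreal (overshoot_density a b x u)"
  proof (rule AE_I2)
    fix u
    have "(\<lambda>n. overshoot_density a b (xs n) u) \<longlonglongrightarrow> overshoot_density a b x u"
    proof (cases "u < 0")
      case True
      then show ?thesis unfolding overshoot_density_def if_P[OF True]
        using x by (intro tendsto_intros xs) auto
    qed (simp add: overshoot_density_def)
    then show "(\<lambda>n. ennreal (overshoot_density a b (xs n) u)) \<longlonglongrightarrow> ennreal (overshoot_density a b x u)"
      by (rule tendsto_ennrealI)
  qed
qed measurable

lemma exit_time_halfline:
  "exit_time Y {0<..} \<omega> =
     (if \<exists>t\<ge>0. Y t \<omega> \<le> 0 then ennreal (Inf {t. 0 \<le> t \<and> Y t \<omega> \<le> 0}) else \<infinity>)"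
proof -
  define T where "T = {t. 0 \<le> t \<and> Y t \<omega> \<le> 0}"
  have e: "exit_time Y {0<..} \<omega> = Inf (ennreal ` T)"
    unfolding exit_time_def T_def by (simp add: not_less)
  show ?thesis
  proof (cases "T = {}")
    case True
    then show ?thesis unfolding e by (auto simp: T_def)
  next
    case False
    have bdd: "bdd_below T" by (auto simp: T_def intro!: bdd_belowI[of _ 0])
    have T0: "0 \<le> Inf T" using False by (intro cInf_greatest) (auto simp: T_def)
    have "Inf (ennreal ` T) = ennreal (Inf T)"
    proof (rule antisym)
      show "ennreal (Inf T) \<le> Inf (ennreal ` T)"
        using cInf_lower[OF _ bdd] by (auto intro!: Inf_greatest ennreal_leI)
      show "Inf (ennreal ` T) \<le> ennreal (Inf T)"
      proof (rule ennreal_le_epsilon)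
        fix d :: real assume "0 < d"
        then have "Inf T < Inf T + d" by simp
        then obtain t where "t \<in> T" "t < Inf T + d" using cInf_lessD[OF False] by blast
        then have "Inf (ennreal ` T) \<le> ennreal (Inf T + d)"
          by (intro order_trans[OF Inf_lower[of "ennreal t"]] ennreal_leI) auto
        then show "Inf (ennreal ` T) \<le> ennreal (Inf T) + ennreal d"
          using T0 \<open>0 < d\<close> by simp
      qed
    qed
    then show ?thesis using False unfolding e by (auto simp: T_def)
  qed
qed

lemma borel_measurable_completion_AE_eq:
  fixes f g :: "'a \<Rightarrow> 'b::topological_space"
  assumes g: "g \<in> borel_measurable M" and eq: "AE \<omega> in M. f \<omega> = g \<omega>"
  shows "f \<in> borel_measurable (completion M)"
proof (rule measurableI)
  fix A :: "'b set" assume A: "A \<in> sets borel"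
  have [measurable]: "g \<in> borel_measurable (completion M)" using g by (rule measurable_completion)
  have [measurable]: "Measurable.pred (completion M) (\<lambda>\<omega>. f \<omega> \<noteq> g \<omega> \<and> f \<omega> \<in> A)"
    "Measurable.pred (completion M) (\<lambda>\<omega>. f \<omega> \<noteq> g \<omega>)"
    using eq by (auto intro!: sets_completion_AE elim!: eventually_mono)
  have "Measurable.pred (completion M) (\<lambda>\<omega>. (\<not> f \<omega> \<noteq> g \<omega> \<and> g \<omega> \<in> A) \<or> (f \<omega> \<noteq> g \<omega> \<and> f \<omega> \<in> A))"
    using A by measurable
  then have "{\<omega> \<in> space (completion M). (\<not> f \<omega> \<noteq> g \<omega> \<and> g \<omega> \<in> A) \<or> (f \<omega> \<noteq> g \<omega> \<and> f \<omega> \<in> A)} \<in> sets (completion M)"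
    by (simp add: pred_def)
  also have "{\<omega> \<in> space (completion M). (\<not> f \<omega> \<noteq> g \<omega> \<and> g \<omega> \<in> A) \<or> (f \<omega> \<noteq> g \<omega> \<and> f \<omega> \<in> A)} = f -` A \<inter> space (completion M)"
    by auto
  finally show "f -` A \<inter> space (completion M) \<in> sets (completion M)" .
qed simp

context regular_relativistic_process
begin

text \<open>
  The weighted law that the theorem computes, with the first negative time in place of the exit time.  It is a
  measure on the whole line.
\<close>

definition hitting_law :: "real \<Rightarrow> real measure" where
  "hitting_law x = distr (density M (\<lambda>\<omega>. ennreal (discount x \<omega>))) borel (\<lambda>\<omega>. path x \<omega> (first_negative (path x \<omega>)))"

lemma sets_hitting_law [measurable_cong, simp]: "sets (hitting_law x) = sets borel"
  by (simp add: hitting_law_def)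

lemma nn_integral_hitting_law:
  assumes [measurable]: "f \<in> borel_measurable borel"
  shows "(\<integral>\<^sup>+u. f u \<partial>hitting_law x) =
     (\<integral>\<^sup>+\<omega>. ennreal (discount x \<omega>) * f (path x \<omega> (first_negative (path x \<omega>))) \<partial>M)"
  unfolding hitting_law_def by (subst nn_integral_distr) (auto simp: nn_integral_density)

lemma AE_hitting_law_nonpos: "AE u in hitting_law x. u \<le> 0"
  unfolding hitting_law_def
  by (subst AE_distr_iff, measurable, subst AE_density, measurable)
     (auto simp: discount_def intro!: value_first_negative_nonpos path_right_continuous)

lemma emeasure_gamma_tail_measurable [measurable]:
  "(\<lambda>u. emeasure (gamma_measure a (2 * b)) {u - y<..}) \<in> borel_measurable borel"
  unfolding emeasure_gamma_tail by measurable

text \<open>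
  After weighting with \<open>exp (b u)\<close>, both measures are finite, carried by \<open>(- \<infinity>, 0]\<close>, and have the same Gamma tail
  integrals.
\<close>

lemma hitting_law_eq:
  assumes x: "0 < x"
  shows "hitting_law x = density lborel (\<lambda>u. ennreal (overshoot_density a b x u))"
proof -
  let ?P = "density lborel (\<lambda>u. ennreal (overshoot_density a b x u))" and ?G = "gamma_measure a (2 * b)"
  let ?e = "\<lambda>u. ennreal (exp (b * u))"
  interpret G: real_distribution ?G using a b by (intro real_distribution_gamma) auto
  have left: "(\<integral>\<^sup>+u. emeasure ?G {u - y<..} \<partial>density (hitting_law x) ?e) = ennreal (exp (b * x)) * emeasure ?G {x - y<..}"
    if "y \<le> 0" for y
    using balayage_gamma_tail[OF that, of x] by (simp add: nn_integral_density nn_integral_hitting_law)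
  have right: "(\<integral>\<^sup>+u. emeasure ?G {u - y<..} \<partial>density ?P ?e) = ennreal (exp (b * x)) * emeasure ?G {x - y<..}"
    if "y \<le> 0" for y
    using overshoot_density_potential[OF a b x that] overshoot_density_nonneg[OF a x]
    by (simp add: nn_integral_density ennreal_mult' mult.assoc)
  have one: "emeasure ?G {u - 0<..} = 1" if "u \<le> 0" for u
    using AE_gamma_measure_pos[of a "2 * b"] that
    by (intro G.emeasure_eq_1_AE) (auto elim!: eventually_mono)
  have fin: "finite_measure L" if "AE u in L. u \<le> 0"
    "(\<integral>\<^sup>+u. emeasure ?G {u - 0<..} \<partial>L) = ennreal (exp (b * x)) * emeasure ?G {x - 0<..}" for L :: "real measure"
  proof
    have "emeasure L (space L) = (\<integral>\<^sup>+u. 1 \<partial>L)" by simp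
    also have "\<dots> = (\<integral>\<^sup>+u. emeasure ?G {u - 0<..} \<partial>L)"
      using that(1) by (intro nn_integral_cong_AE) (auto elim!: eventually_mono simp: one[simplified])
    finally show "emeasure L (space L) \<noteq> \<infinity>"
      using that(2) by (simp add: G.emeasure_eq_measure ennreal_mult_eq_top_iff)
  qed
  have neg_left: "AE u in density (hitting_law x) ?e. u \<le> 0"
    using AE_hitting_law_nonpos[of x] by (simp add: AE_density)
  have neg_right: "AE u in density ?P ?e. u \<le> 0"
    by (simp add: AE_density overshoot_density_def)
  have eq: "density (hitting_law x) ?e = density ?P ?e"
    using a b
  proof (intro gamma_tails_determine_measure[of a "2 * b"] neg_left neg_right)
    show "finite_measure (density (hitting_law x) ?e)" by (intro fin neg_left left) simp
    show "finite_measure (density ?P ?e)" by (intro fin neg_right right) simp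
  qed (auto simp: left right)
  \<comment> \<open>The weight \<open>exp (b u)\<close> is positive, so it can be divided out again.\<close>
  have "density (density L ?e) (\<lambda>u. ennreal (exp (- b * u))) = L" if [measurable_cong]: "sets L = sets borel" for L
  proof -
    have "ennreal (exp (b * u)) * ennreal (exp (- b * u)) = 1" for u
      by (simp add: ennreal_mult'[symmetric] exp_add[symmetric])
    then have "density (density L ?e) (\<lambda>u. ennreal (exp (- b * u))) = density L (\<lambda>_. 1)"
      by (subst density_density_eq) (auto simp del: density_1)
    then show ?thesis by (simp add: density_1)
  qed
  from this[of "hitting_law x"] this[of ?P] eq show ?thesis by simp
qed

lemma discount_antimono_start:
  assumes "x' \<le> x" shows "discount x \<omega> \<le> discount x' \<omega>"
proof (cases "goes_negative (path x \<omega>)")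
  case True
  then have neg': "goes_negative (path x' \<omega>)" using assms unfolding goes_negative_def by (meson add_mono_thms_linordered_semiring(3) le_less_trans)
  have "first_negative (path x' \<omega>) \<le> first_negative (path x \<omega>)"
    unfolding first_negative_def using neg' True assms
    by (auto simp: goes_negative_def intro!: cInf_superset_mono bdd_belowI[of _ 0])
  then show ?thesis using True neg' m_pos by (simp add: discount_def)
qed (use discount_bounds[of x' \<omega>] in \<open>simp add: discount_def\<close>)

lemma discount_mass:
  assumes "0 < x"
  shows "(\<integral>\<^sup>+\<omega>. ennreal (discount x \<omega>) \<partial>M) = (\<integral>\<^sup>+u. ennreal (overshoot_density a b x u) \<partial>lborel)"
proof -
  have "(\<integral>\<^sup>+\<omega>. ennreal (discount x \<omega>) \<partial>M) = (\<integral>\<^sup>+u. 1 \<partial>hitting_law x)"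
    by (subst nn_integral_hitting_law) auto
  also have "\<dots> = (\<integral>\<^sup>+u. ennreal (overshoot_density a b x u) \<partial>lborel)"
    unfolding hitting_law_eq[OF assms] by (subst nn_integral_density) auto
  finally show ?thesis .
qed

text \<open>
  The discount decreases in the starting point, so its left limit dominates it; by continuity of the explicit mass both have the
  same finite expectation, hence they agree almost surely.
\<close>

lemma AE_discount_left_continuous:
  assumes x: "0 < x" and xs: "\<And>n. x / 2 \<le> xs n" "\<And>n. xs n \<le> x" "xs \<longlonglongrightarrow> x"
  shows "AE \<omega> in M. (INF n. ennreal (discount (xs n) \<omega>)) = ennreal (discount x \<omega>)"
proof -
  let ?d = "\<lambda>\<omega>. ennreal (discount x \<omega>)" and ?L = "\<lambda>\<omega>. INF n. ennreal (discount (xs n) \<omega>)"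
  have pos: "0 < xs n" for n using x xs(1)[of n] by linarith
  have le: "?d \<omega> \<le> ?L \<omega>" for \<omega>
    using discount_antimono_start[OF xs(2)] by (intro INF_greatest ennreal_leI)
  have lim: "(\<lambda>n. \<integral>\<^sup>+\<omega>. ennreal (discount (xs n) \<omega>) \<partial>M) \<longlonglongrightarrow> (\<integral>\<^sup>+\<omega>. ?d \<omega> \<partial>M)"
    unfolding discount_mass[OF x] discount_mass[OF pos] by (rule overshoot_mass_continuous[OF a b x xs])
  have "(\<integral>\<^sup>+\<omega>. ?L \<omega> \<partial>M) \<le> (\<integral>\<^sup>+\<omega>. ?d \<omega> \<partial>M)"
    by (rule tendsto_lowerbound[OF lim]) (auto intro!: always_eventually nn_integral_mono INF_lower)
  moreover have fin: "(\<integral>\<^sup>+\<omega>. ?d \<omega> \<partial>M) \<noteq> \<infinity>"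
  proof -
    have "(\<integral>\<^sup>+\<omega>. ?d \<omega> \<partial>M) \<le> (\<integral>\<^sup>+\<omega>. 1 \<partial>M)"
      using discount_bounds by (intro nn_integral_mono) simp
    then have "(\<integral>\<^sup>+\<omega>. ?d \<omega> \<partial>M) \<le> 1" by (simp add: emeasure_space_1)
    then show ?thesis using neq_top_trans[OF ennreal_one_neq_top] by simp
  qed
  ultimately have "(\<integral>\<^sup>+\<omega>. ?L \<omega> - ?d \<omega> \<partial>M) = 0"
    using le by (subst nn_integral_diff) (auto simp: diff_eq_0_iff_ennreal less_top[symmetric] top_unique)
  then have "AE \<omega> in M. ?L \<omega> - ?d \<omega> = 0"
    by (subst (asm) nn_integral_0_iff_AE) measurable
  then show ?thesis
  proof eventually_elim
    fix \<omega> assume "?L \<omega> - ?d \<omega> = 0"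
    then have "?L \<omega> \<le> ?d \<omega>" by (simp add: diff_eq_0_iff_ennreal)
    with le[of \<omega>] show "?L \<omega> = ?d \<omega>" by (rule antisym[rotated])
  qed
qed

text \<open>
  A path from \<open>x\<close> that is nonpositive at some time belongs to a path from \<open>x' < x\<close> that is negative at that
  time.  Letting \<open>x'\<close> increase to \<open>x\<close> squeezes the discount at the exit time between two equal values.
\<close>

lemma AE_exit_time_eq:
  assumes x: "0 < x"
  shows "AE \<omega> in M. exit_time (\<lambda>t \<omega>. x + X t \<omega>) {0<..} \<omega> =
     (if goes_negative (path x \<omega>) then ennreal (first_negative (path x \<omega>)) else \<infinity>)"
proof -
  define xs where "xs n = x - x / (real n + 2)" for n
  have xs: "x / 2 \<le> xs n" "xs n \<le> x" "xs n < x" for n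
    using x by (auto simp: xs_def field_simps)
  have "(\<lambda>n. x - x / (real n + 2)) \<longlonglongrightarrow> x - 0"
    using LIMSEQ_ignore_initial_segment[OF lim_const_over_n, of x 2]
    by (intro tendsto_diff tendsto_const) (simp add: add.commute)
  then have lim: "xs \<longlonglongrightarrow> x" by (simp add: xs_def[abs_def])
  show ?thesis
    using AE_discount_left_continuous[OF x xs(1,2) lim]
  proof eventually_elim
    fix \<omega> assume eq: "(INF n. ennreal (discount (xs n) \<omega>)) = ennreal (discount x \<omega>)"
    define T where "T = {t. 0 \<le> t \<and> x + X t \<omega> \<le> 0}"
    have bdd: "bdd_below T" by (auto simp: T_def intro!: bdd_belowI[of _ 0])
    have et: "exit_time (\<lambda>t \<omega>. x + X t \<omega>) {0<..} \<omega> = (if T \<noteq> {} then ennreal (Inf T) else \<infinity>)"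
      unfolding exit_time_halfline T_def by auto
    show "exit_time (\<lambda>t \<omega>. x + X t \<omega>) {0<..} \<omega> = (if goes_negative (path x \<omega>) then ennreal (first_negative (path x \<omega>)) else \<infinity>)"
    proof (cases "T = {}")
      case True
      then have "\<not> goes_negative (path x \<omega>)" by (auto simp: goes_negative_def T_def)
      with True show ?thesis by (simp add: et)
    next
      case False
      have "exp (- m * Inf T) \<le> discount (xs n) \<omega>" for n
      proof -
        have neg: "0 \<le> t \<and> path (xs n) \<omega> t < 0" if "t \<in> T" for t
          using that xs(3)[of n] by (auto simp: T_def)
        then have "goes_negative (path (xs n) \<omega>)" using False by (auto simp: goes_negative_def)
        moreover have "first_negative (path (xs n) \<omega>) \<le> Inf T"
          using neg False by (intro cInf_greatest first_negative_le) auto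
        ultimately show ?thesis using m_pos by (simp add: discount_def)
      qed
      then have "ennreal (exp (- m * Inf T)) \<le> ennreal (discount x \<omega>)"
        unfolding eq[symmetric] by (intro INF_greatest ennreal_leI)
      then have le: "exp (- m * Inf T) \<le> discount x \<omega>"
        using discount_bounds(1) by (simp add: ennreal_le_iff)
      have neg: "goes_negative (path x \<omega>)"
        using le exp_gt_zero[of "- m * Inf T"] by (auto simp: discount_def split: if_splits)
      then have "first_negative (path x \<omega>) \<le> Inf T"
        using le m_pos by (simp add: discount_def)
      moreover have "Inf T \<le> first_negative (path x \<omega>)"
        unfolding first_negative_def if_P[OF neg] using neg bdd
        by (intro cInf_superset_mono) (auto simp: goes_negative_def T_def)
      ultimately show ?thesis using neg False by (simp add: et)
    qed
  qed
qed

end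

text \<open>
  The integrand of the exit measure agrees almost surely with a measurable function built from the first
  negative time, so it is measurable for the completion and its integrals are those of \<open>hitting_law\<close>.  The set function is
  therefore the restriction of a measure.
\<close>

lemma (in regular_relativistic_process) exit_measure_eq:
  fixes Y :: "real \<Rightarrow> 'w \<Rightarrow> real"
  assumes x: "0 < x" and Y: "AE \<omega> in M. \<forall>t. X t \<omega> = Y t \<omega>"
  shows "exit_measure M (\<lambda>t \<omega>. x + Y t \<omega>) m {0<..} =
           density (restrict_space lborel {..0}) (\<lambda>u. ennreal (overshoot_density a b x u))"
proof -
  let ?Y = "\<lambda>t \<omega>. x + Y t \<omega>"
  let ?R = "density (restrict_space lborel {..0}) (\<lambda>u. ennreal (overshoot_density a b x u))"
  let ?f = "\<lambda>A \<omega>. indicator {\<omega>. exit_time ?Y {0<..} \<omega> < \<infinity>} \<omega> * exp (- m * enn2real (exit_time ?Y {0<..} \<omega>)) *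
      indicator A (?Y (enn2real (exit_time ?Y {0<..} \<omega>)) \<omega>) :: real"
  let ?g = "\<lambda>A \<omega>. discount x \<omega> * indicator A (path x \<omega> (first_negative (path x \<omega>))) :: real"
  have compl: "- {0<..} = {..0::real}" by auto
  have sets_R: "sets ?R = sets (restrict_space borel {..0})" by (simp cong: sets_restrict_space_cong)
  have space_R: "space ?R = {..0}" by (simp add: space_restrict_space)
  have AE_eq: "AE \<omega> in M. \<forall>A. ?f A \<omega> = ?g A \<omega>"
    using AE_exit_time_eq[OF x] Y
  proof eventually_elim
    fix \<omega> assume *: "exit_time (\<lambda>t \<omega>. x + X t \<omega>) {0<..} \<omega> =
        (if goes_negative (path x \<omega>) then ennreal (first_negative (path x \<omega>)) else \<infinity>)"
      and XY: "\<forall>t. X t \<omega> = Y t \<omega>"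
    have "exit_time ?Y {0<..} \<omega> = exit_time (\<lambda>t \<omega>. x + X t \<omega>) {0<..} \<omega>"
      by (simp add: exit_time_def XY)
    then show "\<forall>A. ?f A \<omega> = ?g A \<omega>"
      using XY by (auto simp: * discount_def first_negative_nonneg)
  qed
  have mass: "ennreal (\<integral>\<omega>. ?f A \<omega> \<partial>completion M) = emeasure ?R A" if A: "A \<in> sets (restrict_space borel {..0})" for A
  proof -
    have A': "A \<in> sets borel" "A \<subseteq> {..0}" using A by (auto simp: sets_restrict_space_iff)
    note A'(1)[measurable]
    have g_meas: "?g A \<in> borel_measurable M" by measurable
    have AE_A: "AE \<omega> in M. ?f A \<omega> = ?g A \<omega>" using AE_eq by eventually_elim simp
    have "(\<integral>\<omega>. ?f A \<omega> \<partial>completion M) = (\<integral>\<omega>. ?g A \<omega> \<partial>completion M)"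
      by (rule integral_cong_AE[OF borel_measurable_completion_AE_eq[OF g_meas AE_A] measurable_completion[OF g_meas] AE_completion[OF AE_A]])
    also have "\<dots> = (\<integral>\<omega>. ?g A \<omega> \<partial>M)" by (rule integral_completion[OF g_meas])
    finally have "ennreal (\<integral>\<omega>. ?f A \<omega> \<partial>completion M) = (\<integral>\<^sup>+\<omega>. ennreal (?g A \<omega>) \<partial>M)"
    proof -
      assume eq: "(\<integral>\<omega>. ?f A \<omega> \<partial>completion M) = (\<integral>\<omega>. ?g A \<omega> \<partial>M)"
      have "integrable M (?g A)"
        using discount_bounds by (intro integrable_const_bound[of _ 1] AE_I2 g_meas) (auto simp: indicator_def)
      then show ?thesis unfolding eq
        using discount_bounds(1) by (intro nn_integral_eq_integral[symmetric]) auto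
    qed
    also have "\<dots> = (\<integral>\<^sup>+u. indicator A u \<partial>hitting_law x)"
      unfolding nn_integral_hitting_law[OF borel_measurable_indicator[OF A'(1)]]
      using discount_bounds(1) by (intro nn_integral_cong) (auto simp: indicator_def)
    also have "\<dots> = (\<integral>\<^sup>+u. ennreal (overshoot_density a b x u) * indicator A u \<partial>lborel)"
      unfolding hitting_law_eq[OF x] by (subst nn_integral_density) auto
    also have "\<dots> = (\<integral>\<^sup>+u. ennreal (overshoot_density a b x u) * indicator A u * indicator {..0} u \<partial>lborel)"
      using A'(2) by (intro nn_integral_cong) (auto simp: indicator_def)
    also have "\<dots> = (\<integral>\<^sup>+u. ennreal (overshoot_density a b x u) * indicator A u \<partial>restrict_space lborel {..0})"
      by (rule nn_integral_restrict_space[symmetric]) simp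
    also have "\<dots> = emeasure ?R A"
      using A by (intro emeasure_density[symmetric])
        (auto intro!: measurable_restrict_space1 cong: sets_restrict_space_cong)
    finally show ?thesis .
  qed
  have "exit_measure M ?Y m {0<..} = measure_of {..0} (sets (restrict_space borel {..0})) (\<lambda>A. ennreal (\<integral>\<omega>. ?f A \<omega> \<partial>completion M))"
    unfolding exit_measure_def compl ..
  also have "\<dots> = measure_of {..0} (sets (restrict_space borel {..0})) (emeasure ?R)"
  proof (rule measure_of_eq)
    show "sets (restrict_space borel {..0::real}) \<subseteq> Pow {..0}"
      using sets.space_closed[of "restrict_space borel {..0::real}"] by (simp add: space_restrict_space)
    fix A assume "A \<in> sigma_sets {..0::real} (sets (restrict_space borel {..0}))"
    then have "A \<in> sets (restrict_space borel {..0})"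
      using sets.sigma_sets_eq[of "restrict_space borel {..0::real}"] by (simp add: space_restrict_space)
    then show "ennreal (\<integral>\<omega>. ?f A \<omega> \<partial>completion M) = emeasure ?R A" by (rule mass)
  qed
  also have "\<dots> = ?R"
    using measure_of_of_measure[of ?R] unfolding space_R sets_R .
  finally show ?thesis .
qed

theorem theorem3p1:
  fixes M :: "'w measure" and X :: "real \<Rightarrow> 'w \<Rightarrow> real" and \<alpha> m x :: real
  assumes "0 < \<alpha>" "\<alpha> < 2" "0 < m"
    and "relativistic_stable_process M X \<alpha> m"
    and "0 < x"
  shows "\<exists>Q :: real \<Rightarrow> real.
           Q \<in> borel_measurable borel \<and> (\<forall>u. 0 \<le> Q u) \<and>
           exit_measure M (\<lambda>t \<omega>. x + X t \<omega>) m {0<..} =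
             density (restrict_space lborel {..0}) (\<lambda>u. ennreal (Q u)) \<and>
           (\<forall>u<0. Q u = sin (pi * \<alpha> / 2) / pi * (x / (- u)) powr (\<alpha> / 2) *
                          (exp (- (m powr (1 / \<alpha>)) * (x - u)) / (x - u)))"
proof -
  obtain X' where X': "regular_relativistic_process M X' \<alpha> m" and eq: "AE \<omega> in M. \<forall>t. X' t \<omega> = X t \<omega>"
    using regular_version[OF assms(4,1,2,3)] by blast
  interpret regular_relativistic_process M X' \<alpha> m by fact
  show ?thesis
  proof (intro exI[of _ "overshoot_density (\<alpha> / 2) (m powr (1 / \<alpha>)) x"] conjI allI impI)
    show "overshoot_density a b x \<in> borel_measurable borel" by measurable
    show "0 \<le> overshoot_density a b x u" for u
      using a assms(5) by (rule overshoot_density_nonneg)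
    show "exit_measure M (\<lambda>t \<omega>. x + X t \<omega>) m {0<..} =
        density (restrict_space lborel {..0}) (\<lambda>u. ennreal (overshoot_density a b x u))"
      using assms(5) eq by (rule exit_measure_eq)
    show "overshoot_density a b x u = sin (pi * \<alpha> / 2) / pi * (x / (- u)) powr (\<alpha> / 2) *
        (exp (- (m powr (1 / \<alpha>)) * (x - u)) / (x - u))" if "u < 0" for u
      using that by (simp add: overshoot_density_def)
  qed
qed

end
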